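(* Let $A\in\mathbb{R}^{n\times n}$, $B\in\mathbb{R}^{n\times m}$, and let $\mathcal{A}\in\{0,*\}^{n\times n}$, $\mathcal{B}\in\{0,*\}^{n\times m}$ be pattern matrices. The following statements are equivalent: 1) The perturbed system is structurally controllable, i.e. there exist $\Delta A\in[\mathcal{A}]$ and $\Delta B\in[\mathcal{B}]$ such that $(A+\Delta A,B+\Delta B)$ is controllable. 2) (a) For each eigenvalue $\lambda_i\in\sigma(A)$, $$\max_{\Delta A\in[\mathcal{A}],\,\Delta B\in[\mathcal{B}]}\operatorname{rank}[\lambda_i I-A-\Delta A,\;B+\Delta B]=n;$$ and (b) every edge $e\in E_{xz}$ of the auxiliary connection digraph $\mathcal{G}_{\rm auc}$ is input-reachable. 3) (a) For each $\lambda_i\in\sigma(A)$, the intersection of the column matroid of the $n\times(2n+m)$ matrix $[I_n,\ \lambda_i I-A,\ B]$ and the column matroid of the $(n+m)\times(2n+m)$ matrix $[[\mathcal{A},\mathcal{B}]^\intercal,\ \bar I_{n+m}]$ (both on the ground set $[2n+m]$) has cardinality $n$; and (b) every vertex $z_i\in V_z$ is input-reachable in $\mathcal{G}_{\rm auc}$.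
   Context: A pattern matrix is a matrix with entries in $\{0,*\}$. For $\mathcal{M}\in\{0,*\}^{n_1\times n_2}$, $[\mathcal{M}]=\{M\in\mathbb{R}^{n_1\times n_2}: M_{ij}=0 \text{ whenever } \mathcal{M}_{ij}=0\}$. The generic rank $\operatorname{grank}\mathcal{M}$ is the maximum rank of an element of $[\mathcal{M}]$. $\bar I_k$ denotes the $k\times k$ diagonal pattern matrix with all diagonal entries $*$. Controllability of $(A,B)$ means the controllability matrix $[B,AB,\dots,A^{n-1}B]$ has rank $n$; $\sigma(A)$ is the set of (complex) eigenvalues of $A$, and ranks with complex $\lambda_i$ are over $\mathbb{C}$. For a matrix $W$ with $q$ columns (possibly containing pattern/free entries), its column matroid is $([q],\mathcal{I}_W)$ with $\mathcal{I}_W=\{I\subseteq[q]: \operatorname{rank}W(:,I)=|I|\}$ (using generic rank when $W$ contains $*$ entries, treating the $*$ entries as independent free parameters). The cardinality of the intersection of two matroids on the same ground set is the maximum size of a set independent in both. Auxiliary connection digraph (ACG) $\mathcal{G}_{\rm auc}$: define the rational matrices $G_{zx}(\lambda)=\begin{bmatrix}(\lambda I-A)^{-1}\\ 0_{m\times n}\end{bmatrix}$ and $G_{zu}(\lambda)=\begin{bmatrix}(\lambda I-A)^{-1}B\\ I_m\end{bmatrix}$ (both $(n+m)$-row). Vertex set $V_z\cup V_x\cup V_u$ with $V_z=\{z_1,\dots,z_{n+m}\}$, $V_x=\{x_1,\dots,x_n\}$, $V_u=\{u_1,\dots,u_m\}$. Edge set $E_{xz}\cup E_{uz}\cup E_{zx}$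 where $E_{xz}=\{(x_j,z_i): [G_{zx}(\lambda)]_{ij}\not\equiv 0\}$, $E_{uz}=\{(u_j,z_i):[G_{zu}(\lambda)]_{ij}\not\equiv0\}$, $E_{zx}=\{(z_i,x_j): [\mathcal{A},\mathcal{B}]_{ji}=*\}$. A vertex is input-reachable if there is a directed path from some vertex of $V_u$ ending at it; an edge in $E_{xz}$ is input-reachable if its start or end vertex is input-reachable. *)

theory Defs
  imports Complex_Main "Jordan_Normal_Form.DL_Rank_Submatrix" "Jordan_Normal_Form.Char_Poly"
begin

text \<open>Pattern matrices: entries True = *, False = 0.\<close>
type_synonym pattern = "bool mat"

definition realizations :: "pattern \<Rightarrow> real mat set" where
  "realizations P = {M. M \<in> carrier_mat (dim_row P) (dim_col P) \<and>
     (\<forall>i<dim_row P. \<forall>j<dim_col P. \<not> P $$ (i,j) \<longrightarrow> M $$ (i,j) = 0)}"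

text \<open>Horizontal concatenation [M, N].\<close>
definition hconcat :: "'a mat \<Rightarrow> 'a mat \<Rightarrow> 'a mat" where
  "hconcat M N = mat (dim_row M) (dim_col M + dim_col N)
     (\<lambda>(i,j). if j < dim_col M then M $$ (i,j) else N $$ (i, j - dim_col M))"

text \<open>The diagonal pattern \<open>\<bar>I\<^sub>k\<close>.\<close>
definition diag_pattern :: "nat \<Rightarrow> pattern" where
  "diag_pattern k = mat k k (\<lambda>(i,j). i = j)"

text \<open>Controllability matrix [B, AB, ..., A^(n-1) B], n = dim_row A.\<close>
definition ctrb_mat :: "'a::comm_ring_1 mat \<Rightarrow> 'a mat \<Rightarrow> 'a mat" where
  "ctrb_mat A B = mat (dim_row A) (dim_row A * dim_col B)
     (\<lambda>(i,j). ((A ^\<^sub>m (j div dim_col B)) * B) $$ (i, j mod dim_col B))"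

definition controllable :: "real mat \<Rightarrow> real mat \<Rightarrow> bool" where
  "controllable A B = (vec_space.rank (dim_row A) (ctrb_mat A B) = dim_row A)"

definition cmat :: "real mat \<Rightarrow> complex mat" where
  "cmat M = map_mat complex_of_real M"

text \<open>Structural controllability of the perturbed system.\<close>
definition struct_controllable :: "real mat \<Rightarrow> real mat \<Rightarrow> pattern \<Rightarrow> pattern \<Rightarrow> bool" where
  "struct_controllable A B PA PB =
     (\<exists>dA \<in> realizations PA. \<exists>dB \<in> realizations PB. controllable (A + dA) (B + dB))"

text \<open>max over perturbations of rank [lambda I - A - dA, B + dB] (over the complex numbers).\<close>
definition max_pert_rank :: "real mat \<Rightarrow> real mat \<Rightarrow> pattern \<Rightarrow> pattern \<Rightarrow> complex \<Rightarrow> nat" where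
  "max_pert_rank A B PA PB lam = Max {vec_space.rank (dim_row A)
       (hconcat (lam \<cdot>\<^sub>m 1\<^sub>m (dim_row A) - cmat A - cmat dA) (cmat (B + dB))) |
       dA dB. dA \<in> realizations PA \<and> dB \<in> realizations PB}"

text \<open>Column matroid independence of a numeric matrix W.\<close>
definition col_indep :: "'a::field mat \<Rightarrow> nat set \<Rightarrow> bool" where
  "col_indep W I = (I \<subseteq> {..<dim_col W} \<and>
     vec_space.rank (dim_row W) (submatrix W {..<dim_row W} I) = card I)"

text \<open>Column matroid independence of a pattern matrix (generic rank, *-entries
  independent free parameters, i.e. maximal rank over all real realizations).\<close>
definition pattern_col_indep :: "pattern \<Rightarrow> nat set \<Rightarrow> bool" where
  "pattern_col_indep P I = (I \<subseteq> {..<dim_col P} \<and>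
     Max {vec_space.rank (dim_row P) (submatrix M {..<dim_row P} I) | M. M \<in> realizations P}
       = card I)"

text \<open>Cardinality of the intersection of two matroids on ground set {..<q}.\<close>
definition matroid_inter_card :: "nat \<Rightarrow> (nat set \<Rightarrow> bool) \<Rightarrow> (nat set \<Rightarrow> bool) \<Rightarrow> nat" where
  "matroid_inter_card q I1 I2 = Max {card I | I. I \<subseteq> {..<q} \<and> I1 I \<and> I2 I}"

text \<open>[[\<A>, \<B>]^T, \<bar>I_{n+m}]\<close>
definition W_pattern :: "pattern \<Rightarrow> pattern \<Rightarrow> pattern" where
  "W_pattern PA PB = hconcat (transpose_mat (hconcat PA PB)) (diag_pattern (dim_col PA + dim_col PB))"

text \<open>[I_n, lambda I - A, B]\<close>
definition W_num :: "real mat \<Rightarrow> real mat \<Rightarrow> complex \<Rightarrow> complex mat" where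
  "W_num A B lam = hconcat (hconcat (1\<^sub>m (dim_row A)) (lam \<cdot>\<^sub>m 1\<^sub>m (dim_row A) - cmat A)) (cmat B)"

text \<open>Auxiliary connection digraph.\<close>
datatype vertex = Z nat | X nat | U nat

text \<open>The rational function entry ((lambda I - A)^{-1} M)_{ij} is not identically zero,
  i.e. it is nonzero at some lambda where lambda I - A is invertible.\<close>
definition resolvent_entry_nz :: "real mat \<Rightarrow> real mat \<Rightarrow> nat \<Rightarrow> nat \<Rightarrow> bool" where
  "resolvent_entry_nz A M i j = (\<exists>lam::complex. \<exists>R \<in> carrier_mat (dim_row A) (dim_row A).
      R * (lam \<cdot>\<^sub>m 1\<^sub>m (dim_row A) - cmat A) = 1\<^sub>m (dim_row A) \<and> (R * cmat M) $$ (i,j) \<noteq> 0)"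

definition E_xz :: "real mat \<Rightarrow> real mat \<Rightarrow> (vertex \<times> vertex) set" where
  "E_xz A B = (let n = dim_row A; m = dim_col B in
     {(X j, Z i) | i j. i < n + m \<and> j < n \<and> i < n \<and> resolvent_entry_nz A (1\<^sub>m n) i j})"

definition E_uz :: "real mat \<Rightarrow> real mat \<Rightarrow> (vertex \<times> vertex) set" where
  "E_uz A B = (let n = dim_row A; m = dim_col B in
     {(U j, Z i) | i j. i < n + m \<and> j < m \<and>
        (if i < n then resolvent_entry_nz A B i j else i - n = j)})"

definition E_zx :: "pattern \<Rightarrow> pattern \<Rightarrow> (vertex \<times> vertex) set" where
  "E_zx PA PB = {(Z i, X j) | i j. i < dim_col PA + dim_col PB \<and> j < dim_row PA \<and>
      hconcat PA PB $$ (j, i)}"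

definition acg_edges :: "real mat \<Rightarrow> real mat \<Rightarrow> pattern \<Rightarrow> pattern \<Rightarrow> (vertex \<times> vertex) set" where
  "acg_edges A B PA PB = E_xz A B \<union> E_uz A B \<union> E_zx PA PB"

definition input_reachable :: "real mat \<Rightarrow> real mat \<Rightarrow> pattern \<Rightarrow> pattern \<Rightarrow> vertex \<Rightarrow> bool" where
  "input_reachable A B PA PB v = (\<exists>j < dim_col B. (U j, v) \<in> (acg_edges A B PA PB)\<^sup>*)"

definition edge_input_reachable :: "real mat \<Rightarrow> real mat \<Rightarrow> pattern \<Rightarrow> pattern \<Rightarrow> vertex \<times> vertex \<Rightarrow> bool" where
  "edge_input_reachable A B PA PB e =
     (input_reachable A B PA PB (fst e) \<or> input_reachable A B PA PB (snd e))"

end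

theory Submission
  imports Defs
    "HOL-Computational_Algebra.Fundamental_Theorem_Algebra"
    "HOL-Computational_Algebra.Field_as_Ring"
begin

text \<open>
  Collect the free entries in a real parameter vector \<open>\<theta>\<close>. The pencil
  \<open>[\<lambda>I - A - dA, B + dB]\<close> and all its maximal minors are affine in each single parameter. By the
  Popov--Belevitch--Hautus test, controllability means that the minors, as polynomials in \<open>\<lambda>\<close>, have
  no common root.

  Reachability of all \<open>z\<^sub>i\<close> yields parameters for which every column is avoided by some nonzero minor;
  among these choose one minimising the degree of the gcd of the minors. A parameter in column
  \<open>i\<close> does not occur in a minor avoiding column \<open>i\<close>, so by minimality moving it keeps every common
  root. Since such parameters are Zariski dense, a common root would be one for all parameters,
  contradicting the rank condition. Conversely, the unit row vectors at unreachable \<open>z\<^sub>i\<close> generate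
  an invariant space annihilating the perturbed \<open>B\<close>.

  The rank condition and the matroid condition agree because the perturbed pencil is the product
  of \<open>[I, \<lambda>I - A, B]\<close> with a realization of the transposed pattern matrix.
\<close>

section \<open>Full row rank, minors and rank\<close>

text \<open>The rank condition treats one \<lambda> at a time. A generic parameter serves the
  finitely many eigenvalues of \<open>A\<close> together, but a perturbation may create further
  uncontrollable modes whose position depends on the parameter, so genericity at fixed points is not
  enough. Reachability excludes such moving roots: \<open>z\<close> stacks state and input, and when
  \<open>z_i\<close> is reachable, some input influences it generically, so the pencil keeps full
  row rank over the rational functions without column \<open>i\<close>. Hence some nonzero minor
  does not see the parameters of column \<open>i\<close>, and no common root can move with them.

  Genericity is handled without multivariate polynomials: a minor is affine in each parameter, so a
  single move spoils its nonvanishing for finitely many values only, and two good values determine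
  an affine function. Matrices appear as functions of row and column, so that deleting or adjoining
  columns needs no reindexing.\<close>

definition full_row :: "nat \<Rightarrow> nat set \<Rightarrow> (nat \<Rightarrow> nat \<Rightarrow> 'a::field) \<Rightarrow> bool" where
  "full_row n K h \<longleftrightarrow>
     (\<forall>q. (\<forall>k\<in>K. (\<Sum>a<n. q a * h a k) = 0) \<longrightarrow> (\<forall>a<n. q a = 0))"

lemma full_rowD:
  "full_row n K h \<Longrightarrow> (\<And>k. k \<in> K \<Longrightarrow> (\<Sum>a<n. q a * h a k) = 0) \<Longrightarrow> a < n \<Longrightarrow> q a = 0"
  unfolding full_row_def by blast

lemma full_row_mono: "full_row n K h \<Longrightarrow> K \<subseteq> K' \<Longrightarrow> full_row n K' h"
  unfolding full_row_def by blast

lemma full_row_cong: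
  assumes "\<And>a k. a < n \<Longrightarrow> k \<in> K \<Longrightarrow> h a k = h' a k"
  shows "full_row n K h = full_row n K h'"
proof -
  have "(\<Sum>a<n. q a * h a k) = (\<Sum>a<n. q a * h' a k)" if "k \<in> K" for q k
    using assms that by (intro sum.cong) auto
  then show ?thesis unfolding full_row_def by simp
qed

lemma det_eq_0_iff_left_kernel:
  fixes h :: "nat \<Rightarrow> nat \<Rightarrow> 'a::field"
  shows "det (mat n n (\<lambda>(a,b). h a b)) = 0 \<longleftrightarrow>
    (\<exists>q. (\<exists>a<n. q a \<noteq> 0) \<and> (\<forall>b<n. (\<Sum>a<n. q a * h a b) = 0))"
proof -
  let ?M = "mat n n (\<lambda>(a,b). h a b)"
  have T: "transpose_mat ?M \<in> carrier_mat n n" by simp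
  have "det ?M = 0 \<longleftrightarrow> det (transpose_mat ?M) = 0"
    by (subst det_transpose[of _ n]) auto
  also have "\<dots> \<longleftrightarrow> (\<exists>v. v \<in> carrier_vec n \<and> v \<noteq> 0\<^sub>v n \<and> transpose_mat ?M *\<^sub>v v = 0\<^sub>v n)"
    by (rule det_0_iff_vec_prod_zero_field[OF T])
  also have "\<dots> \<longleftrightarrow> (\<exists>q. (\<exists>a<n. q a \<noteq> 0) \<and> (\<forall>b<n. (\<Sum>a<n. q a * h a b) = 0))"
  proof
    assume "\<exists>v. v \<in> carrier_vec n \<and> v \<noteq> 0\<^sub>v n \<and> transpose_mat ?M *\<^sub>v v = 0\<^sub>v n"
    then obtain v where v: "v \<in> carrier_vec n" "v \<noteq> 0\<^sub>v n" "transpose_mat ?M *\<^sub>v v = 0\<^sub>v n" by blast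
    have "\<exists>a<n. v $ a \<noteq> 0" using v(1,2) by auto
    moreover have "(\<Sum>a<n. v $ a * h a b) = 0" if "b < n" for b
    proof -
      have "(transpose_mat ?M *\<^sub>v v) $ b = 0" using v(3) that by simp
      then show ?thesis using that v(1)
        by (simp add: scalar_prod_def mult.commute atLeast0LessThan)
    qed
    ultimately show "\<exists>q. (\<exists>a<n. q a \<noteq> 0) \<and> (\<forall>b<n. (\<Sum>a<n. q a * h a b) = 0)" by blast
  next
    assume "\<exists>q. (\<exists>a<n. q a \<noteq> 0) \<and> (\<forall>b<n. (\<Sum>a<n. q a * h a b) = 0)"
    then obtain q where q: "\<exists>a<n. q a \<noteq> 0" "\<And>b. b<n \<Longrightarrow> (\<Sum>a<n. q a * h a b) = 0" by blast
    have "vec n q \<noteq> 0\<^sub>v n" using q(1) by (metis index_vec index_zero_vec(1))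
    moreover have "transpose_mat ?M *\<^sub>v vec n q = 0\<^sub>v n"
      using q(2) by (intro eq_vecI) (auto simp: scalar_prod_def mult.commute atLeast0LessThan)
    ultimately show "\<exists>v. v \<in> carrier_vec n \<and> v \<noteq> 0\<^sub>v n \<and> transpose_mat ?M *\<^sub>v v = 0\<^sub>v n"
      by (intro exI[of _ "vec n q"]) auto
  qed
  finally show ?thesis .
qed

lemma det_neq_0_iff_full_row:
  fixes h :: "nat \<Rightarrow> nat \<Rightarrow> 'a::field"
  shows "det (mat n n (\<lambda>(a,b). h a (f b))) \<noteq> 0 \<longleftrightarrow> full_row n (f ` {..<n}) h"
  using det_eq_0_iff_left_kernel[of n "\<lambda>a b. h a (f b)"] unfolding full_row_def by auto

text \<open>Padding with zero columns gives a square matrix whose right kernel contains a unit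
  vector; its determinant vanishes, so it has a left kernel as well.\<close>

lemma underdetermined_system:
  fixes h :: "nat \<Rightarrow> nat \<Rightarrow> 'a::field"
  assumes "finite K" "card K < n"
  shows "\<exists>q. (\<exists>a<n. q a \<noteq> 0) \<and> (\<forall>k\<in>K. (\<Sum>a<n. q a * h a k) = 0)"
proof -
  obtain e where e: "bij_betw e {..<card K} K"
    using assms(1) ex_bij_betw_nat_finite atLeast0LessThan by metis
  let ?h = "\<lambda>a b. if b < card K then h a (e b) else 0"
  have "\<exists>c. (\<exists>a<n. c a \<noteq> 0) \<and> (\<forall>b<n. (\<Sum>a<n. c a * ?h b a) = (0::'a))"
    by (rule exI[of _ "\<lambda>a. if a = card K then 1 else 0"])
       (use assms(2) in \<open>auto intro!: sum.neutral\<close>)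
  then have "det (mat n n (\<lambda>(a,b). ?h b a)) = 0"
    unfolding det_eq_0_iff_left_kernel[of n "\<lambda>a b. ?h b a"] .
  moreover have "mat n n (\<lambda>(a,b). ?h b a) = transpose_mat (mat n n (\<lambda>(a,b). ?h a b))"
    by (intro eq_matI) auto
  ultimately have "det (mat n n (\<lambda>(a,b). ?h a b)) = 0"
    by (simp add: det_transpose[of _ n])
  then obtain q where q: "\<exists>a<n. q a \<noteq> 0" "\<And>b. b<n \<Longrightarrow> (\<Sum>a<n. q a * ?h a b) = 0"
    unfolding det_eq_0_iff_left_kernel[of n ?h] by blast
  have "(\<Sum>a<n. q a * h a k) = 0" if kK: "k \<in> K" for k
  proof -
    obtain b where b: "b < card K" "k = e b"
      using bij_betw_imp_surj_on[OF e] kK by blast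
    show ?thesis using q(2)[of b] b assms(2) by auto
  qed
  with q(1) show ?thesis by blast
qed

text \<open>More than \<open>n\<close> columns satisfy a linear relation. Minimality supplies a
  nonzero \<open>q\<close> annihilating every column but one that occurs in the relation; the
  relation makes \<open>q\<close> annihilate that one too.\<close>

lemma full_row_minimal_card:
  fixes h :: "nat \<Rightarrow> nat \<Rightarrow> 'a::field"
  assumes fin: "finite K" and full: "full_row n K h"
    and min: "\<And>k. k \<in> K \<Longrightarrow> \<not> full_row n (K - {k}) h"
  shows "card K = n"
proof (rule antisym)
  show "n \<le> card K"
  proof (rule ccontr)
    assume "\<not> n \<le> card K"
    then obtain q where "\<exists>a<n. q a \<noteq> 0" "\<forall>k\<in>K. (\<Sum>a<n. q a * h a k) = 0"
      using underdetermined_system[OF fin, of n h] by auto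
    then show False using full unfolding full_row_def by blast
  qed
  show "card K \<le> n"
  proof (rule ccontr)
    assume "\<not> card K \<le> n"
    then have lt: "card {..<n} < card K" by simp
    obtain e where e: "bij_betw e {..<card K} K"
      using fin ex_bij_betw_nat_finite atLeast0LessThan by metis
    obtain c where c: "\<exists>b<card K. c b \<noteq> 0" "\<And>a. a<n \<Longrightarrow> (\<Sum>b<card K. c b * h a (e b)) = 0"
      using underdetermined_system[OF finite_lessThan lt, of "\<lambda>b a. h a (e b)"] by auto
    obtain b0 where b0: "b0 < card K" "c b0 \<noteq> 0" using c(1) by blast
    have "e b0 \<in> K" using e b0 by (auto simp: bij_betw_def)
    from min[OF this] obtain q where q: "\<And>k. k \<in> K - {e b0} \<Longrightarrow> (\<Sum>a<n. q a * h a k) = 0"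
      "\<exists>a<n. q a \<noteq> 0" unfolding full_row_def by blast
    have other: "(\<Sum>a<n. q a * h a (e b)) = 0" if "b < card K" "b \<noteq> b0" for b
      using that e b0 by (intro q(1)) (auto simp: bij_betw_def inj_on_def)
    have "0 = (\<Sum>a<n. q a * (\<Sum>b<card K. c b * h a (e b)))"
      by (rule sym, rule sum.neutral) (simp add: c(2))
    also have "\<dots> = (\<Sum>b<card K. c b * (\<Sum>a<n. q a * h a (e b)))"
      unfolding sum_distrib_left by (subst sum.swap) (simp add: ac_simps)
    also have "\<dots> = (\<Sum>b\<in>{b0}. c b * (\<Sum>a<n. q a * h a (e b)))"
      by (rule sum.mono_neutral_right) (use b0 other in auto)
    finally have "(\<Sum>a<n. q a * h a (e b0)) = 0" using b0 by simp
    then have "\<forall>k\<in>K. (\<Sum>a<n. q a * h a k) = 0" using q(1) by blast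
    then show False using full q(2) unfolding full_row_def by blast
  qed
qed

lemma full_row_imp_minor:
  fixes h :: "nat \<Rightarrow> nat \<Rightarrow> 'a::field"
  assumes "finite K" "full_row n K h"
  obtains f where "f \<in> {..<n} \<rightarrow>\<^sub>E K" "det (mat n n (\<lambda>(a,b). h a (f b))) \<noteq> 0"
proof -
  define C where "C = {L. L \<subseteq> K \<and> full_row n L h}"
  have "finite C" "C \<noteq> {}" using assms by (auto simp: C_def)
  then obtain L where L: "L \<in> C" "\<And>L'. L' \<in> C \<Longrightarrow> \<not> L' \<subset> L"
    by (metis finite_has_minimal order_less_imp_not_less psubset_eq)
  have finL: "finite L" using L(1) assms(1) by (auto simp: C_def intro: finite_subset)
  have "card L = n"
    using L(1) L(2)[of "L - {_}"] finL by (intro full_row_minimal_card) (auto simp: C_def)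
  then obtain e where e: "bij_betw e {..<n} L"
    using finL ex_bij_betw_nat_finite atLeast0LessThan by metis
  define f where "f = restrict e {..<n}"
  have f: "f ` {..<n} = L" using e by (auto simp: f_def bij_betw_def)
  show thesis
  proof
    show "f \<in> {..<n} \<rightarrow>\<^sub>E K" using f L(1) by (auto simp: f_def C_def)
    show "det (mat n n (\<lambda>(a,b). h a (f b))) \<noteq> 0"
      unfolding det_neq_0_iff_full_row f using L(1) by (simp add: C_def)
  qed
qed

lemma full_row_iff_minor:
  fixes h :: "nat \<Rightarrow> nat \<Rightarrow> 'a::field"
  assumes "finite K"
  shows "full_row n K h \<longleftrightarrow> (\<exists>f \<in> {..<n} \<rightarrow>\<^sub>E K. det (mat n n (\<lambda>(a,b). h a (f b))) \<noteq> 0)"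
proof
  assume "full_row n K h"
  then show "\<exists>f \<in> {..<n} \<rightarrow>\<^sub>E K. det (mat n n (\<lambda>(a,b). h a (f b))) \<noteq> 0"
    by (rule full_row_imp_minor[OF assms]) auto
next
  assume "\<exists>f \<in> {..<n} \<rightarrow>\<^sub>E K. det (mat n n (\<lambda>(a,b). h a (f b))) \<noteq> 0"
  then obtain f where "f \<in> {..<n} \<rightarrow>\<^sub>E K" "full_row n (f ` {..<n}) h"
    unfolding det_neq_0_iff_full_row by blast
  then show "full_row n K h" by (elim full_row_mono) auto
qed

section \<open>Rank in terms of right and left kernels\<close>

lemma rank_eq_dim_col_iff:
  fixes M :: "'a::field mat"
  assumes M: "M \<in> carrier_mat r c"
  shows "vec_space.rank r M = c \<longleftrightarrow>
    (\<forall>v. (\<forall>i<r. (\<Sum>j<c. M $$ (i,j) * v j) = 0) \<longrightarrow> (\<forall>j<c. v j = 0))" (is "?L \<longleftrightarrow> ?R")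
proof -
  interpret vec_space "TYPE('a)" r .
  \<comment> \<open>The library's rank is attained by an independent subset of the set of columns; a
    repeated column would leave this set with fewer than \<open>c\<close> elements.\<close>
  have dist: "distinct (cols M)" if "rank M = c"
  proof -
    obtain S where S: "maximal S (\<lambda>T. T \<subseteq> set (cols M) \<and> lin_indpt T)"
      using maximal_exists[of "(\<lambda>T. T \<subseteq> set (cols M) \<and> lin_indpt T)" "card (set (cols M))" "{}"]
      by (meson List.finite_set card_mono empty_iff empty_subsetI finite_lin_indpt2 rev_finite_subset)
    then have "card S \<le> card (set (cols M))" by (simp add: card_mono maximal_def)
    then have "c \<le> card (set (cols M))" using rank_card_indpt[OF M S] that by simp
    then show ?thesis using M card_distinct card_length[of "cols M"] cols_length[of M]
      by (metis carrier_matD(2) le_antisym)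
  qed
  have key: "?R \<longleftrightarrow> (\<forall>v \<in> carrier_vec c. M *\<^sub>v v = 0\<^sub>v r \<longrightarrow> v = 0\<^sub>v c)"
  proof
    assume R: ?R
    show "\<forall>v \<in> carrier_vec c. M *\<^sub>v v = 0\<^sub>v r \<longrightarrow> v = 0\<^sub>v c"
    proof (intro ballI impI eq_vecI)
      fix v i assume v: "v \<in> carrier_vec c" "M *\<^sub>v v = 0\<^sub>v r" and i: "i < dim_vec (0\<^sub>v c)"
      have "(\<Sum>j<c. M $$ (i,j) * v $ j) = 0" if "i < r" for i
        using arg_cong[OF v(2), of "\<lambda>w. w $ i"] that M v(1)
        by (simp add: scalar_prod_def atLeast0LessThan)
      then show "v $ i = 0\<^sub>v c $ i" using R[rule_format, of "\<lambda>j. v $ j" i] i by auto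
    qed simp
  next
    assume inj: "\<forall>v \<in> carrier_vec c. M *\<^sub>v v = 0\<^sub>v r \<longrightarrow> v = 0\<^sub>v c"
    show ?R
    proof (intro allI impI)
      fix v j assume v: "\<forall>i<r. (\<Sum>j<c. M $$ (i,j) * v j) = 0" and j: "j < c"
      have "M *\<^sub>v vec c v = 0\<^sub>v r"
        using v M by (intro eq_vecI) (auto simp: scalar_prod_def atLeast0LessThan)
      then have "vec c v = 0\<^sub>v c" using inj by auto
      then show "v j = 0" using j by (metis index_vec index_zero_vec(1))
    qed
  qed
  show ?thesis unfolding key
  proof
    assume L: "rank M = c"
    have "lin_indpt (set (cols M))" using full_rank_lin_indpt[OF M L dist[OF L]] .
    then show "\<forall>v \<in> carrier_vec c. M *\<^sub>v v = 0\<^sub>v r \<longrightarrow> v = 0\<^sub>v c"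
      using lin_depI[OF M _ _ _ dist[OF L]] by blast
  next
    assume R: "\<forall>v \<in> carrier_vec c. M *\<^sub>v v = 0\<^sub>v r \<longrightarrow> v = 0\<^sub>v c"
    have d: "distinct (cols M)"
    proof (rule ccontr)
      assume "\<not> distinct (cols M)"
      then obtain i j where ij: "i \<noteq> j" "i < c" "j < c" "col M i = col M j"
        using distinct_conv_nth[of "cols M"] M by (metis carrier_matD(2) cols_length cols_nth)
      have unit: "M *\<^sub>v unit_vec c k = col M k" if "k < c" for k
        using that M by (intro eq_vecI) auto
      let ?v = "unit_vec c i - unit_vec c j :: 'a vec"
      have Mv: "M *\<^sub>v ?v = 0\<^sub>v r"
        unfolding mult_minus_distrib_mat_vec[OF M unit_vec_carrier unit_vec_carrier]
          unit[OF ij(2)] unit[OF ij(3)] ij(4) using M by (intro eq_vecI) simp_all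
      have cv: "?v \<in> carrier_vec c" by simp
      have v0: "?v = 0\<^sub>v c" by (rule mp[OF bspec[OF R cv] Mv])
      have "?v $ i = 0" unfolding v0 by (rule index_zero_vec(1)[OF ij(2)])
      then show False using ij(1-3) by simp
    qed
    have "lin_indpt (set (cols M))"
    proof
      assume "lin_dep (set (cols M))"
      from lin_depE[OF M this d] obtain v where
        "v \<in> carrier_vec c" "v \<noteq> 0\<^sub>v c" "M *\<^sub>v v = 0\<^sub>v r" .
      with R show False by simp
    qed
    then show "rank M = c" by (rule lin_indpt_full_rank[OF M d])
  qed
qed

lemma rank_eq_dim_row_iff:
  fixes M :: "'a::field mat"
  assumes M: "M \<in> carrier_mat r c"
  shows "vec_space.rank r M = r \<longleftrightarrow> full_row r {..<c} (\<lambda>a k. M $$ (a,k))"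
    and rank_le_dim_row: "vec_space.rank r M \<le> r"
proof -
  interpret vec_space "TYPE('a)" r .
  have colsM: "set (cols M) \<subseteq> carrier_vec r" using M cols_dim by blast
  obtain S where S: "maximal S (\<lambda>T. T \<subseteq> set (cols M) \<and> lin_indpt T)"
    using maximal_exists[of "(\<lambda>T. T \<subseteq> set (cols M) \<and> lin_indpt T)" "card (set (cols M))" "{}"]
    by (meson List.finite_set card_mono empty_iff empty_subsetI finite_lin_indpt2 rev_finite_subset)
  then have S': "S \<subseteq> set (cols M)" "lin_indpt S" by (auto simp: maximal_def)
  have cS: "rank M = card S" by (rule rank_card_indpt[OF M S])
  show le: "rank M \<le> r"
    unfolding cS using li_le_dim(2)[of S] S' colsM fin_dim dim_is_n by fastforce
  show "rank M = r \<longleftrightarrow> full_row r {..<c} (\<lambda>a k. M $$ (a,k))"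
  proof
    assume "rank M = r"
    then have cr: "card S = r" using cS by simp
    obtain xs where xs: "set xs = S" "distinct xs"
      using finite_distinct_list[of S] S'(1) finite_subset by blast
    have len: "length xs = r" using xs cr distinct_card by fastforce
    let ?X = "mat_of_cols r xs"
    have xsc: "set xs \<subseteq> carrier_vec r" using xs S' colsM by blast
    have X: "?X \<in> carrier_mat r r" using len by auto
    have cX: "cols ?X = xs" using xsc by (simp add: cols_mat_of_cols)
    have "rank ?X = r" using lin_indpt_full_rank[OF X] cX xs S' by simp
    then have "det ?X \<noteq> 0" using det_rank_iff[OF X] by simp
    moreover have "?X = mat r r (\<lambda>(a,b). xs ! b $ a)"
      using len by (intro eq_matI) (auto simp: mat_of_cols_def)
    ultimately have fX: "full_row r ((\<lambda>b. b) ` {..<r}) (\<lambda>a b. xs ! b $ a)"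
      using det_neq_0_iff_full_row[of r "\<lambda>a b. xs ! b $ a" "\<lambda>b. b"] by simp
    show "full_row r {..<c} (\<lambda>a k. M $$ (a,k))"
      unfolding full_row_def
    proof (intro allI impI)
      fix q a assume q: "\<forall>k\<in>{..<c}. (\<Sum>a<r. q a * M $$ (a,k)) = 0" and a: "a < r"
      show "q a = 0"
      proof (rule full_rowD[OF fX _ a])
        fix b assume "b \<in> (\<lambda>b. b) ` {..<r}"
        then have "xs ! b \<in> set (cols M)" using len xs S' by (metis image_ident lessThan_iff nth_mem subsetD)
        then obtain k where "k < c" "xs ! b = col M k"
          using M by (metis carrier_matD(2) cols_length cols_nth in_set_conv_nth)
        then show "(\<Sum>a<r. q a * xs ! b $ a) = 0" using q M by auto
      qed
    qed
  next
    assume "full_row r {..<c} (\<lambda>a k. M $$ (a,k))"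
    then obtain f where f: "f \<in> {..<r} \<rightarrow>\<^sub>E {..<c}"
      and d: "det (mat r r (\<lambda>(a,b). M $$ (a, f b))) \<noteq> 0" (is "det ?X \<noteq> 0")
      using full_row_imp_minor[of "{..<c}" r "\<lambda>a k. M $$ (a,k)"] by auto
    have X: "?X \<in> carrier_mat r r" by simp
    have rX: "rank ?X = r" using det_rank_iff[OF X] d by simp
    have sub: "set (cols ?X) \<subseteq> set (cols M)"
    proof
      fix x assume "x \<in> set (cols ?X)"
      then obtain b where b: "b < r" "x = col ?X b"
        by (metis X carrier_matD(2) cols_length cols_nth in_set_conv_nth)
      have fb: "f b < c" using f b by auto
      have "x = col M (f b)" using b fb M by (intro eq_vecI) auto
      then show "x \<in> set (cols M)" using fb M
        by (metis carrier_matD(2) cols_length cols_nth nth_mem)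
    qed
    have "distinct (cols ?X)" using non_distinct_low_rank[OF X] rX by auto
    moreover from this have "lin_indpt (set (cols ?X))" using full_rank_lin_indpt[OF X rX] by simp
    ultimately have "r \<le> rank M"
      using rank_ge_card_indpt[OF M sub] distinct_card[of "cols ?X"] by simp
    with le show "rank M = r" by simp
  qed
qed

section \<open>Minors of a matrix pencil with free entries\<close>

text \<open>The parameter is a total function on index pairs, of which only the values at starred
  positions enter. Coefficients are complex because the pencil is tested at complex points; the
  parameters stay real.\<close>

definition pert_poly ::
  "(nat \<Rightarrow> nat \<Rightarrow> complex poly) \<Rightarrow> (nat \<Rightarrow> nat \<Rightarrow> bool) \<Rightarrow> (nat \<times> nat \<Rightarrow> real) \<Rightarrow> nat \<Rightarrow> nat \<Rightarrow> complex poly" where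
  "pert_poly h0 st \<theta> a k = h0 a k + (if st a k then [:of_real (\<theta> (a,k)):] else 0)"

text \<open>\<open>f\<close> lists the chosen columns in order; repetitions are allowed and give the
  zero polynomial.\<close>

definition pert_minor ::
  "(nat \<Rightarrow> nat \<Rightarrow> complex poly) \<Rightarrow> (nat \<Rightarrow> nat \<Rightarrow> bool) \<Rightarrow> nat \<Rightarrow> (nat \<Rightarrow> nat) \<Rightarrow> (nat \<times> nat \<Rightarrow> real) \<Rightarrow> complex poly" where
  "pert_minor h0 st n f \<theta> = det (mat n n (\<lambda>(a,b). pert_poly h0 st \<theta> a (f b)))"

lemma poly_pert_minor:
  "poly (pert_minor h0 st n f \<theta>) \<mu> = det (mat n n (\<lambda>(a,b). poly (pert_poly h0 st \<theta> a (f b)) \<mu>))"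
  unfolding pert_minor_def by (rule poly_det_cong[of _ n]) auto

lemma full_row_iff_pert_minor:
  assumes "finite K"
  shows "full_row n K (\<lambda>a k. poly (pert_poly h0 st \<theta> a k) \<mu>) \<longleftrightarrow>
    (\<exists>f \<in> {..<n} \<rightarrow>\<^sub>E K. poly (pert_minor h0 st n f \<theta>) \<mu> \<noteq> 0)"
  unfolding full_row_iff_minor[OF assms] poly_pert_minor ..

lemma pert_minor_cong:
  assumes "\<And>a b. a < n \<Longrightarrow> b < n \<Longrightarrow> pert_poly h0 st \<theta> a (f b) = pert_poly h0' st' \<theta>' a (f' b)"
  shows "pert_minor h0 st n f \<theta> = pert_minor h0' st' n f' \<theta>'"
  unfolding pert_minor_def using assms by (intro arg_cong[of _ _ det] cong_mat) auto

text \<open>Laplace expansion along the column holding the parameter: the cofactors there do not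
  contain it. The second conclusion, constancy of the minors that avoid the column, is what later
  keeps common roots from moving.\<close>

lemma pert_minor_affine:
  obtains \<alpha> \<beta> where "\<And>t. pert_minor h0 st n f (\<theta>(e := t)) = \<alpha> + smult (of_real t) \<beta>"
    and "snd e \<notin> f ` {..<n} \<Longrightarrow> \<beta> = 0"
proof -
  obtain j i where e: "e = (j,i)" by (cases e)
  consider "i \<notin> f ` {..<n}" | "\<not> inj_on f {..<n}" | "i \<in> f ` {..<n}" "inj_on f {..<n}" by blast
  then show thesis
  proof cases
    case 1
    have "pert_minor h0 st n f (\<theta>(e := t)) = pert_minor h0 st n f \<theta> + smult (of_real t) 0" for t
      using 1 unfolding e by (simp, intro pert_minor_cong) (auto simp: pert_poly_def)
    then show thesis using that[of _ 0] by blast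
  next
    case 2
    then obtain b b' where b: "b < n" "b' < n" "b \<noteq> b'" "f b = f b'" by (auto simp: inj_on_def)
    have "pert_minor h0 st n f \<theta>' = 0" for \<theta>'
      unfolding pert_minor_def using b
      by (intro det_identical_columns[of _ n b b']) (auto intro!: eq_vecI)
    then show thesis using that[of 0 0] by simp
  next
    case 3
    then obtain b where b: "b < n" "f b = i" by blast
    have other: "f b' \<noteq> i" if "b' < n" "b' \<noteq> b" for b'
      using 3(2) b that by (auto simp: inj_on_def)
    define M where "M t = mat n n (\<lambda>(a,b). pert_poly h0 st (\<theta>(e := t)) a (f b))" for t
    have M: "M t \<in> carrier_mat n n" for t by (simp add: M_def)
    have cof: "cofactor (M t) a b = cofactor (M 0) a b" if "a < n" for t a
    proof -
      have "mat_delete (M t) a b = mat_delete (M 0) a b"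
        unfolding mat_delete_def M_def using that b other
        by (intro eq_matI) (auto simp: pert_poly_def e)
      then show ?thesis by (simp add: cofactor_def)
    qed
    define \<alpha> where "\<alpha> = (\<Sum>a<n. pert_poly h0 st (\<theta>(e := 0)) a i * cofactor (M 0) a b)"
    define \<beta> where "\<beta> = (if j < n \<and> st j i then cofactor (M 0) j b else 0)"
    have "pert_minor h0 st n f (\<theta>(e := t)) = \<alpha> + smult (of_real t) \<beta>" for t
    proof -
      have pp: "pert_poly h0 st (\<theta>(e := t)) a i = pert_poly h0 st (\<theta>(e := 0)) a i
          + (if a = j then (if st j i then [:of_real t:] else 0) else 0)" for a
        by (simp add: pert_poly_def e)
      have "pert_minor h0 st n f (\<theta>(e := t)) = (\<Sum>a<n. M t $$ (a,b) * cofactor (M t) a b)"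
        unfolding pert_minor_def M_def[symmetric] by (rule laplace_expansion_column[OF M b(1)])
      also have "\<dots> = (\<Sum>a<n. pert_poly h0 st (\<theta>(e := t)) a i * cofactor (M 0) a b)"
      proof (rule sum.cong[OF refl])
        fix a assume "a \<in> {..<n}"
        then have "M t $$ (a,b) = pert_poly h0 st (\<theta>(e := t)) a i" "cofactor (M t) a b = cofactor (M 0) a b"
          using b by (simp_all add: M_def cof[of a t, unfolded M_def])
        then show "M t $$ (a,b) * cofactor (M t) a b = pert_poly h0 st (\<theta>(e := t)) a i * cofactor (M 0) a b"
          by simp
      qed
      also have "\<dots> = \<alpha> + (\<Sum>a<n. if a = j then (if st j i then [:of_real t:] else 0) * cofactor (M 0) a b else 0)"
        unfolding pp \<alpha>_def sum.distrib[symmetric] by (intro sum.cong) (auto simp: algebra_simps)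
      also have "\<dots> = \<alpha> + smult (of_real t) \<beta>"
        unfolding \<beta>_def by (subst sum.delta) auto
      finally show ?thesis .
    qed
    moreover have "snd e \<notin> f ` {..<n} \<Longrightarrow> \<beta> = 0" using 3(1) e by simp
    ultimately show thesis using that by blast
  qed
qed

text \<open>A coordinatewise substitute for a Zariski open set. \<open>G\<close> need not be given
  by polynomial inequations, which matters because one later instance is cut out by the degree and a
  root of a gcd.\<close>

definition stable_under_moves :: "'e set \<Rightarrow> ('e \<Rightarrow> real) set \<Rightarrow> bool" where
  "stable_under_moves E G \<longleftrightarrow> (\<forall>\<theta>\<in>G. \<forall>e\<in>E. finite {t. \<theta>(e := t) \<notin> G})"

text \<open>Sets stable under moves are Zariski dense as far as coordinatewise affine functions can tell.\<close>

lemma affine_zero_on_stable: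
  fixes h :: "('e \<Rightarrow> real) \<Rightarrow> complex"
  assumes "finite S" "S \<subseteq> E" and st: "stable_under_moves E G"
    and aff: "\<And>\<theta> e. \<exists>\<alpha> \<beta>. \<forall>t. h (\<theta>(e := t)) = \<alpha> + of_real t * \<beta>"
    and zero: "\<And>\<theta>. \<theta> \<in> G \<Longrightarrow> h \<theta> = 0"
    and "\<theta> \<in> G" "\<And>e. e \<notin> S \<Longrightarrow> \<theta>' e = \<theta> e"
  shows "h \<theta>' = 0"
  using assms(1,2,6,7)
proof (induction S arbitrary: \<theta> \<theta>' rule: finite_induct)
  case empty
  then have "\<theta>' = \<theta>" by auto
  then show ?case using empty zero by simp
next
  case (insert e S)
  obtain \<alpha> \<beta> where ab: "\<And>t. h (\<theta>'(e := t)) = \<alpha> + of_real t * \<beta>" using aff by metis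
  \<comment> \<open>Setting coordinate \<open>e\<close> to the same \<open>t\<close> in both points
    leaves them equal outside \<open>S\<close>, so the induction hypothesis applies with a new
    starting point in \<open>G\<close>. Two good values of \<open>t\<close> then kill the affine
    function.\<close>
  have "h (\<theta>'(e := t)) = 0" if "\<theta>(e := t) \<in> G" for t
  proof (rule insert.IH)
    show "S \<subseteq> E" using insert.prems by simp
    show "\<theta>(e := t) \<in> G" by (rule that)
    show "(\<theta>'(e := t)) e' = (\<theta>(e := t)) e'" if "e' \<notin> S" for e'
      using insert.prems(3)[of e'] that by auto
  qed
  then have *: "\<alpha> + of_real t * \<beta> = 0" if "t \<notin> {t. \<theta>(e := t) \<notin> G}" for t
    using ab that by simp
  have fin: "finite {t. \<theta>(e := t) \<notin> G}"
    using st insert.prems by (auto simp: stable_under_moves_def)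
  obtain t1 where t1: "t1 \<notin> {t. \<theta>(e := t) \<notin> G}"
    using ex_new_if_finite[OF infinite_UNIV_char_0 fin] by blast
  obtain t2 where t2: "t2 \<notin> insert t1 {t. \<theta>(e := t) \<notin> G}"
    using ex_new_if_finite[OF infinite_UNIV_char_0, of "insert t1 {t. \<theta>(e := t) \<notin> G}"] fin by blast
  have "\<alpha> + of_real t2 * \<beta> = 0" using * t2 by blast
  with *[OF t1] have "of_real t1 * \<beta> = of_real t2 * \<beta>" by (metis add_left_cancel)
  then have "\<beta> = 0" using t2 by auto
  moreover from this have "\<alpha> = 0" using *[OF t1] by simp
  ultimately have "\<forall>t. h (\<theta>'(e := t)) = 0" using ab by simp
  then have "h (\<theta>'(e := \<theta>' e)) = 0" by blast
  then show ?case by simp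
qed

lemma stable_meets_minor:
  assumes st: "stable_under_moves E G" and G: "\<theta> \<in> G"
    and nz: "poly (pert_minor h0 st n f \<theta>2) \<mu> \<noteq> 0" and E: "{..<n} \<times> f ` {..<n} \<subseteq> E"
  shows "\<exists>\<theta>'\<in>G. poly (pert_minor h0 st n f \<theta>') \<mu> \<noteq> 0"
proof (rule ccontr)
  assume "\<not> ?thesis"
  then have zero: "poly (pert_minor h0 st n f \<theta>') \<mu> = 0" if "\<theta>' \<in> G" for \<theta>' using that by blast
  let ?S = "{..<n} \<times> f ` {..<n}"
  \<comment> \<open>Copying \<theta>2 only on the finitely many entries that the minor reads
    preserves its value and keeps the difference from \<theta> finite.\<close>
  define \<theta>' where "\<theta>' = (\<lambda>e. if e \<in> ?S then \<theta>2 e else \<theta> e)"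
  have "poly (pert_minor h0 st n f \<theta>') \<mu> = 0"
  proof (rule affine_zero_on_stable[where S = ?S and h = "\<lambda>\<theta>. poly (pert_minor h0 st n f \<theta>) \<mu>"])
    show "\<exists>\<alpha> \<beta>. \<forall>t. poly (pert_minor h0 st n f (\<theta>(e := t))) \<mu> = \<alpha> + of_real t * \<beta>" for \<theta> e
    proof -
      obtain \<alpha> \<beta> where "\<And>t. pert_minor h0 st n f (\<theta>(e := t)) = \<alpha> + smult (of_real t) \<beta>"
        by (rule pert_minor_affine[of h0 st n f \<theta> e]) blast
      then show ?thesis by auto
    qed
  qed (use assms zero in \<open>auto simp: \<theta>'_def\<close>)
  moreover have "pert_minor h0 st n f \<theta>' = pert_minor h0 st n f \<theta>2"
    by (rule pert_minor_cong) (auto simp: pert_poly_def \<theta>'_def)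
  ultimately show False using nz by simp
qed

text \<open>An affine function with two zeros vanishes identically; this one is nonzero at
  \<open>t = \<theta> e\<close>, so it has at most one zero.\<close>

lemma pert_minor_nonzero_stable: "finite {t. pert_minor h0 st n f (\<theta>(e := t)) = 0}"
  if "pert_minor h0 st n f \<theta> \<noteq> 0"
proof -
  obtain \<alpha> \<beta> where ab: "\<And>t. pert_minor h0 st n f (\<theta>(e := t)) = \<alpha> + smult (of_real t) \<beta>"
    by (rule pert_minor_affine[of h0 st n f \<theta> e]) blast
  have "t = t'" if "pert_minor h0 st n f (\<theta>(e := t)) = 0" "pert_minor h0 st n f (\<theta>(e := t')) = 0" for t t'
  proof (rule ccontr)
    assume "t \<noteq> t'"
    have "smult (of_real t - of_real t') \<beta> = 0"
      using that unfolding ab by (metis add_left_cancel smult_diff_left diff_self)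
    then have "\<beta> = 0" using \<open>t \<noteq> t'\<close> by simp
    then have "pert_minor h0 st n f (\<theta>(e := \<theta> e)) = 0" using that(1) unfolding ab by simp
    then show False using \<open>pert_minor h0 st n f \<theta> \<noteq> 0\<close> by simp
  qed
  \<comment> \<open>A set with at most one element lies in the singleton of its chosen
    element.\<close>
  then have "{t. pert_minor h0 st n f (\<theta>(e := t)) = 0} \<subseteq> {SOME t. pert_minor h0 st n f (\<theta>(e := t)) = 0}"
    by (auto intro: someI2)
  then show ?thesis by (rule finite_subset) simp
qed

text \<open>The member \<open>f0\<close>, which does not depend on \<open>t\<close>, confines the common roots to a finite set; at each
  of them all but one \<open>t\<close> leave only the multiplicity of the root in \<open>G0\<close>.\<close>

lemma Gcd_affine_family:
  fixes \<alpha> \<beta> :: "'f \<Rightarrow> complex poly"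
  assumes fin: "finite F" and f0: "f0 \<in> F" "\<alpha> f0 \<noteq> 0" "\<beta> f0 = 0"
  defines "g \<equiv> \<lambda>t::real. Gcd ((\<lambda>f. \<alpha> f + smult (of_real t) (\<beta> f)) ` F)"
  obtains G0 where "G0 dvd g 0" "\<And>f. f \<in> F \<Longrightarrow> G0 dvd \<beta> f" "G0 \<noteq> 0" "g 0 \<noteq> 0"
    "finite {t. degree (g t) \<noteq> degree G0}"
proof -
  \<comment> \<open>The gcd of all constant and linear coefficients divides the gcd of the family at
    every \<open>t\<close>.\<close>
  define G0 where "G0 = Gcd (\<alpha> ` F \<union> \<beta> ` F)"
  have dA: "G0 dvd \<alpha> f" and dB: "G0 dvd \<beta> f" if "f \<in> F" for f
    unfolding G0_def using that by (auto intro!: Gcd_dvd)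
  obtain \<alpha>' where \<alpha>': "\<And>f. f \<in> F \<Longrightarrow> \<alpha> f = G0 * \<alpha>' f" using dA unfolding dvd_def by metis
  obtain \<beta>' where \<beta>': "\<And>f. f \<in> F \<Longrightarrow> \<beta> f = G0 * \<beta>' f" using dB unfolding dvd_def by metis
  have G0: "G0 \<noteq> 0" using \<alpha>'[OF f0(1)] f0(2) by auto
  have a0: "\<alpha>' f0 \<noteq> 0" using \<alpha>'[OF f0(1)] f0(2) by auto
  have b0: "\<beta>' f0 = 0" using \<beta>'[OF f0(1)] f0(3) G0 by auto
  have gd: "g t dvd \<alpha> f + smult (of_real t) (\<beta> f)" if "f \<in> F" for t f
    unfolding g_def using that by (intro Gcd_dvd) blast
  have g0: "g t \<noteq> 0" for t using gd[OF f0(1), of t] f0 by auto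
  have Gg: "G0 dvd g t" for t
    unfolding g_def by (rule Gcd_greatest) (auto intro!: dvd_add dvd_smult dA dB)
  define Zs where "Zs = {\<mu>. poly (\<alpha>' f0) \<mu> = 0}"
  have finZ: "finite Zs" unfolding Zs_def by (rule poly_roots_finite[OF a0])
  define bad where "bad \<mu> = {t::real. \<forall>f\<in>F. poly (\<alpha>' f) \<mu> + of_real t * poly (\<beta>' f) \<mu> = 0}" for \<mu>
  have finbad: "finite (bad \<mu>)" for \<mu>
  proof -
    \<comment> \<open>Otherwise \<open>G0\<close> times the linear factor at \<mu> would still
      divide all coefficients, against the choice of \<open>G0\<close> as their gcd.\<close>
    have ex: "\<exists>f\<in>F. poly (\<alpha>' f) \<mu> \<noteq> 0 \<or> poly (\<beta>' f) \<mu> \<noteq> 0"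
    proof (rule ccontr)
      assume "\<not> ?thesis"
      then have z: "[:-\<mu>, 1:] dvd \<alpha>' f" "[:-\<mu>, 1:] dvd \<beta>' f" if "f \<in> F" for f
        using that by (auto simp: poly_eq_0_iff_dvd)
      have "G0 * [:-\<mu>, 1:] dvd Gcd (\<alpha> ` F \<union> \<beta> ` F)"
      proof (rule Gcd_greatest)
        fix p assume "p \<in> \<alpha> ` F \<union> \<beta> ` F"
        then obtain f where f: "f \<in> F" "p = G0 * \<alpha>' f \<or> p = G0 * \<beta>' f" using \<alpha>' \<beta>' by auto
        then show "G0 * [:-\<mu>, 1:] dvd p" using z[OF f(1)] mult_dvd_mono[OF dvd_refl] by blast
      qed
      then have "G0 * [:-\<mu>, 1:] dvd G0" by (simp only: G0_def[symmetric])
      then have "degree (G0 * [:-\<mu>, 1:]) \<le> degree G0" using G0 by (rule dvd_imp_degree_le)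
      then show False using G0 by (subst (asm) degree_mult_eq) auto
    qed
    have "t = t'" if "t \<in> bad \<mu>" "t' \<in> bad \<mu>" for t t'
    proof (rule ccontr)
      assume ne: "t \<noteq> t'"
      have "poly (\<beta>' f) \<mu> = 0 \<and> poly (\<alpha>' f) \<mu> = 0" if f: "f \<in> F" for f
      proof -
        have *: "poly (\<alpha>' f) \<mu> + of_real t * poly (\<beta>' f) \<mu> = 0"
          "poly (\<alpha>' f) \<mu> + of_real t' * poly (\<beta>' f) \<mu> = 0"
          using \<open>t \<in> bad \<mu>\<close> \<open>t' \<in> bad \<mu>\<close> f by (auto simp: bad_def)
        then have "of_real t * poly (\<beta>' f) \<mu> = of_real t' * poly (\<beta>' f) \<mu>" by (metis add_left_cancel)
        then have "poly (\<beta>' f) \<mu> = 0" using ne by simp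
        then show ?thesis using * by simp
      qed
      then show False using ex by blast
    qed
    then have "bad \<mu> \<subseteq> {SOME t. t \<in> bad \<mu>}" by (auto intro: someI2)
    then show ?thesis by (rule finite_subset) simp
  qed
  have "degree (g t) = degree G0" if t: "t \<notin> (\<Union>\<mu>\<in>Zs. bad \<mu>)" for t
  proof -
    obtain w where w: "g t = G0 * w" using Gg by (auto simp: dvd_def)
    have wd: "w dvd \<alpha>' f + smult (of_real t) (\<beta>' f)" if "f \<in> F" for f
    proof -
      have "G0 * w dvd G0 * (\<alpha>' f + smult (of_real t) (\<beta>' f))"
        using gd[OF that, of t] \<alpha>'[OF that] \<beta>'[OF that] by (simp add: w algebra_simps)
      then show ?thesis using G0 by simp
    qed
    have "degree w = 0"
    proof (rule ccontr)
      assume "degree w \<noteq> 0"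
      then obtain \<mu> where \<mu>: "poly w \<mu> = 0"
        using fundamental_theorem_of_algebra[of w] constant_degree by metis
      have r: "poly (\<alpha>' f) \<mu> + of_real t * poly (\<beta>' f) \<mu> = 0" if "f \<in> F" for f
        using wd[OF that] \<mu> by (auto simp: dvd_def) (metis mult_eq_0_iff poly_add poly_mult poly_smult)
      have "\<mu> \<in> Zs" using r[OF f0(1)] b0 by (simp add: Zs_def)
      moreover have "t \<in> bad \<mu>" using r by (simp add: bad_def)
      ultimately show False using t by blast
    qed
    moreover have "w \<noteq> 0" using w g0[of t] by auto
    ultimately show ?thesis unfolding w using G0 by (simp add: degree_mult_eq)
  qed
  then have "{t. degree (g t) \<noteq> degree G0} \<subseteq> (\<Union>\<mu>\<in>Zs. bad \<mu>)" by blast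
  moreover have "finite (\<Union>\<mu>\<in>Zs. bad \<mu>)" using finZ finbad by blast
  ultimately have "finite {t. degree (g t) \<noteq> degree G0}" by (rule finite_subset)
  then show thesis using that[of G0] Gg dB G0 g0 by blast
qed

lemma generic_full_row:
  fixes h0 :: "nat \<Rightarrow> nat \<Rightarrow> complex poly" and st :: "nat \<Rightarrow> nat \<Rightarrow> bool" and n N :: nat
  defines "D \<equiv> pert_minor h0 st n"
  assumes avoid: "\<And>i. i < N \<Longrightarrow> \<exists>\<theta>. \<exists>f \<in> {..<n} \<rightarrow>\<^sub>E {..<N} - {i}. D f \<theta> \<noteq> 0"
    and pointwise: "\<And>\<mu>. \<exists>\<theta>. \<exists>f \<in> {..<n} \<rightarrow>\<^sub>E {..<N}. poly (D f \<theta>) \<mu> \<noteq> 0"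
  shows "\<exists>\<theta>. \<forall>\<mu>. \<exists>f \<in> {..<n} \<rightarrow>\<^sub>E {..<N}. poly (D f \<theta>) \<mu> \<noteq> 0"
proof -
  let ?F = "{..<n} \<rightarrow>\<^sub>E {..<N}" and ?E = "{..<n} \<times> {..<N}"
  have finF: "finite ?F" by (intro finite_PiE) auto
  \<comment> \<open>Avoidance is asked for the first \<open>L\<close> columns only, so that
    nonemptiness follows by induction: a move inside \<open>R L\<close> makes one more minor
    nonzero.\<close>
  define R where "R L = {\<theta>. \<forall>i<L. \<exists>f \<in> {..<n} \<rightarrow>\<^sub>E {..<N} - {i}. D f \<theta> \<noteq> 0}" for L
  have R_stable: "stable_under_moves E (R L)" for L E
    unfolding stable_under_moves_def
  proof (intro ballI)
    fix \<theta> e assume "\<theta> \<in> R L"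
    then obtain f where f: "\<And>i. i < L \<Longrightarrow> f i \<in> {..<n} \<rightarrow>\<^sub>E {..<N} - {i} \<and> D (f i) \<theta> \<noteq> 0"
      unfolding R_def by simp metis
    have "{t. \<theta>(e := t) \<notin> R L} \<subseteq> (\<Union>i<L. {t. D (f i) (\<theta>(e := t)) = 0})"
      using f unfolding R_def by blast
    moreover have "finite (\<Union>i<L. {t. D (f i) (\<theta>(e := t)) = 0})"
      using f unfolding D_def by (auto intro!: pert_minor_nonzero_stable)
    ultimately show "finite {t. \<theta>(e := t) \<notin> R L}" by (rule finite_subset)
  qed
  have "L \<le> N \<Longrightarrow> R L \<noteq> {}" for L
  proof (induction L)
    case 0 show ?case by (auto simp: R_def)
  next
    case (Suc L)
    then obtain \<theta> where th: "\<theta> \<in> R L" by auto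
    obtain \<theta>2 f where f: "f \<in> {..<n} \<rightarrow>\<^sub>E {..<N} - {L}" "D f \<theta>2 \<noteq> 0" using avoid[of L] Suc by auto
    obtain \<mu> where "poly (D f \<theta>2) \<mu> \<noteq> 0" using f(2) poly_all_0_iff_0 by blast
    then obtain \<theta>' where "\<theta>' \<in> R L" "poly (D f \<theta>') \<mu> \<noteq> 0"
      using stable_meets_minor[OF R_stable[of UNIV L] th, of h0 st n f] unfolding D_def by blast
    moreover from this have "D f \<theta>' \<noteq> 0" by auto
    ultimately have "\<theta>' \<in> R (Suc L)" using f(1) unfolding R_def less_Suc_eq by blast
    then show ?case by blast
  qed
  then have ne: "R N \<noteq> {}" by simp
  define g where "g \<theta> = Gcd ((\<lambda>f. D f \<theta>) ` ?F)" for \<theta>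
  obtain \<theta>0 where \<theta>0: "\<theta>0 \<in> R N" "\<And>\<theta>. \<theta> \<in> R N \<Longrightarrow> degree (g \<theta>0) \<le> degree (g \<theta>)"
    using ex_has_least_nat[of "\<lambda>\<theta>. \<theta> \<in> R N" _ "\<lambda>\<theta>. degree (g \<theta>)"] ne by blast
  have root: "poly (g \<theta>) \<mu> = 0 \<longleftrightarrow> (\<forall>f\<in>?F. poly (D f \<theta>) \<mu> = 0)" for \<theta> \<mu>
  proof
    assume "poly (g \<theta>) \<mu> = 0"
    moreover have "g \<theta> dvd D f \<theta>" if "f \<in> ?F" for f unfolding g_def using that by (intro Gcd_dvd) blast
    ultimately show "\<forall>f\<in>?F. poly (D f \<theta>) \<mu> = 0" by (metis dvd_trans poly_eq_0_iff_dvd)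
  next
    assume "\<forall>f\<in>?F. poly (D f \<theta>) \<mu> = 0"
    then have "[:-\<mu>, 1:] dvd g \<theta>"
      unfolding g_def by (intro Gcd_greatest) (auto simp: poly_eq_0_iff_dvd)
    then show "poly (g \<theta>) \<mu> = 0" by (simp add: poly_eq_0_iff_dvd)
  qed
  show ?thesis
  proof (intro exI[of _ \<theta>0] allI, rule ccontr)
    fix \<mu> assume "\<not> (\<exists>f\<in>?F. poly (D f \<theta>0) \<mu> \<noteq> 0)"
    then have \<mu>: "poly (g \<theta>0) \<mu> = 0" by (simp add: root)
    \<comment> \<open>The root is frozen together with the minimal degree; keeping the degree is
      what allows the argument to be repeated after the next move.\<close>
    define G where "G = {\<theta> \<in> R N. degree (g \<theta>) = degree (g \<theta>0) \<and> poly (g \<theta>) \<mu> = 0}"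
    have "stable_under_moves ?E G" unfolding stable_under_moves_def
    proof (intro ballI)
      fix \<theta> e assume \<theta>: "\<theta> \<in> G" and e: "e \<in> ?E"
      have "\<forall>f. \<exists>\<alpha> \<beta>. (\<forall>t. D f (\<theta>(e := t)) = \<alpha> + smult (of_real t) \<beta>) \<and> (snd e \<notin> f ` {..<n} \<longrightarrow> \<beta> = 0)"
        unfolding D_def by (metis pert_minor_affine)
      then obtain \<alpha>0 \<beta> where ab0: "\<And>f t. D f (\<theta>(e := t)) = \<alpha>0 f + smult (of_real t) (\<beta> f)"
        and b0: "\<And>f. snd e \<notin> f ` {..<n} \<Longrightarrow> \<beta> f = 0" by metis
      \<comment> \<open>The family is recentred so that \<open>t = 0\<close> is the present
        parameter and \<alpha> consists of the present minors.\<close>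
      define \<alpha> where "\<alpha> f = D f \<theta>" for f
      have ab: "D f (\<theta>(e := \<theta> e + t)) = \<alpha> f + smult (of_real t) (\<beta> f)" for f t
      proof -
        have "D f \<theta> = \<alpha>0 f + smult (of_real (\<theta> e)) (\<beta> f)" using ab0[of f "\<theta> e"] by simp
        then show ?thesis unfolding \<alpha>_def ab0 by (simp add: smult_add_left)
      qed
      obtain f0 where f0: "f0 \<in> {..<n} \<rightarrow>\<^sub>E {..<N} - {snd e}" "D f0 \<theta> \<noteq> 0"
        using \<theta> e unfolding G_def R_def by auto
      have f0': "f0 \<in> ?F" "\<alpha> f0 \<noteq> 0"
        using f0 by (auto simp: \<alpha>_def PiE_iff)
      have "f0 b \<noteq> snd e" if "b < n" for b using PiE_mem[OF f0(1), of b] that by simp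
      then have "snd e \<notin> f0 ` {..<n}" by force
      then have f0'': "\<beta> f0 = 0" by (rule b0)
      have gt: "g (\<theta>(e := \<theta> e + t)) = Gcd ((\<lambda>f. \<alpha> f + smult (of_real t) (\<beta> f)) ` ?F)" for t
        unfolding g_def ab ..
      have g0: "g \<theta> = g (\<theta>(e := \<theta> e + 0))" by simp
      obtain G0 where "G0 dvd g (\<theta>(e := \<theta> e + 0))" "\<And>f. f \<in> ?F \<Longrightarrow> G0 dvd \<beta> f" "G0 \<noteq> 0"
        "g (\<theta>(e := \<theta> e + 0)) \<noteq> 0" "finite {t. degree (g (\<theta>(e := \<theta> e + t))) \<noteq> degree G0}"
        unfolding gt by (rule Gcd_affine_family[where \<alpha> = \<alpha> and \<beta> = \<beta>, OF finF f0' f0'']) (rule that[unfolded gt])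
      note G0 = this[unfolded g0[symmetric]]
      have shift: "finite {t. P (\<theta>(e := \<theta> e + t))} \<longleftrightarrow> finite {t. P (\<theta>(e := t))}" for P
      proof -
        have "{t. P (\<theta>(e := t))} = (\<lambda>t. \<theta> e + t) ` {t. P (\<theta>(e := \<theta> e + t))}"
          by (auto simp: image_iff) (metis add.commute diff_add_cancel)
        then show ?thesis by (simp add: finite_image_iff)
      qed
      have finR: "finite {t. \<theta>(e := \<theta> e + t) \<notin> R N}"
        using R_stable[of UNIV N] \<theta> unfolding shift[of "\<lambda>x. x \<notin> R N"] stable_under_moves_def G_def by blast
      \<comment> \<open>After almost every move the gcd has the degree of \<open>G0\<close>, and
        \<open>G0\<close> divides the present gcd. As the present degree is least, the two agree up
        to a constant factor. So \<mu> is a root of \<open>G0\<close> and of every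
        \<open>\<beta> f\<close>; being a root of every \<open>\<alpha> f\<close> as well, it
        survives the move.\<close>
      have "degree G0 \<le> degree (g \<theta>)" using G0(1,4) by (rule dvd_imp_degree_le)
      moreover have "degree (g \<theta>) \<le> degree G0"
      proof -
        obtain t where "t \<notin> {t. \<theta>(e := \<theta> e + t) \<notin> R N} \<union> {t. degree (g (\<theta>(e := \<theta> e + t))) \<noteq> degree G0}"
          using ex_new_if_finite[OF infinite_UNIV_char_0 finite_UnI[OF finR G0(5)]] by blast
        then show ?thesis using \<theta>0(2)[of "\<theta>(e := \<theta> e + t)"] \<theta> unfolding G_def by auto
      qed
      ultimately have deg: "degree (g \<theta>) = degree G0" by simp
      obtain w where w: "g \<theta> = G0 * w" using G0(1) by (auto simp: dvd_def)
      have "w \<noteq> 0" "degree w = 0" using w G0(3,4) deg by (auto simp: degree_mult_eq)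
      then have "poly w \<mu> \<noteq> 0" by (auto elim!: degree_eq_zeroE)
      then have "poly G0 \<mu> = 0" using \<theta> w unfolding G_def by auto
      then have b\<mu>: "poly (\<beta> f) \<mu> = 0" if "f \<in> ?F" for f
        using G0(2)[OF that] by (metis dvd_trans poly_eq_0_iff_dvd)
      have a\<mu>: "poly (\<alpha> f) \<mu> = 0" if "f \<in> ?F" for f
        using \<theta> that root unfolding G_def \<alpha>_def by blast
      have "poly (g (\<theta>(e := \<theta> e + t))) \<mu> = 0" for t
        unfolding root ab using a\<mu> b\<mu> by simp
      then have "{t. \<theta>(e := \<theta> e + t) \<notin> G} \<subseteq>
          {t. \<theta>(e := \<theta> e + t) \<notin> R N} \<union> {t. degree (g (\<theta>(e := \<theta> e + t))) \<noteq> degree G0}"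
        using deg \<theta> unfolding G_def by auto
      then have "finite {t. \<theta>(e := \<theta> e + t) \<notin> G}"
        using finite_UnI[OF finR G0(5)] by (rule finite_subset)
      then show "finite {t. \<theta>(e := t) \<notin> G}" unfolding shift[of "\<lambda>x. x \<notin> G"] .
    qed
    moreover have "\<theta>0 \<in> G" using \<theta>0 \<mu> by (simp add: G_def)
    moreover obtain \<theta>2 f where f: "f \<in> ?F" "poly (D f \<theta>2) \<mu> \<noteq> 0" using pointwise by blast
    moreover have "{..<n} \<times> f ` {..<n} \<subseteq> ?E" using PiE_mem[OF f(1)] by blast
    ultimately obtain \<theta>' where "\<theta>' \<in> G" "poly (D f \<theta>') \<mu> \<noteq> 0"
      using stable_meets_minor[of ?E G \<theta>0 h0 st n f \<theta>2 \<mu>] unfolding D_def by blast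
    then show False using root f(1) unfolding G_def by blast
  qed
qed

text \<open>Raising the entry \<open>(j,i)\<close> by \<open>0\<close> or by \<open>1\<close> succeeds at generic parameters: if both failed, the
  two left kernel vectors would be proportional and contradict \<open>S\<close>.\<close>

lemma avoiding_minor_step:
  fixes h0 :: "nat \<Rightarrow> nat \<Rightarrow> complex poly"
  assumes i: "i < N" "i \<noteq> l" and j: "j < n" "st j i"
    and Ci: "\<exists>\<theta>. \<exists>f \<in> {..<n} \<rightarrow>\<^sub>E {..<N} - {i}. pert_minor h0 st n f \<theta> \<noteq> 0"
    and S: "full_row n (insert N ({..<N} - {l}))
      (\<lambda>a k. if k = N then (if a = j then 1 else 0) else poly (pert_poly h0 st \<theta>2 a k) \<mu>2)"
  shows "\<exists>\<theta>. \<exists>f \<in> {..<n} \<rightarrow>\<^sub>E {..<N} - {l}. pert_minor h0 st n f \<theta> \<noteq> 0"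
proof (rule ccontr)
  assume neg: "\<not> ?thesis"
  \<comment> \<open>The unit vector at \<open>j\<close> becomes an unstarred column with the fresh
    index \<open>N\<close>, so that \<open>S\<close> too is the nonvanishing of a minor in the same
    parameters.\<close>
  define h0' where "h0' a k = (if k = N then (if a = j then 1 else 0) else h0 a k)" for a k
  define st' where "st' a k = (k \<noteq> N \<and> st a k)" for a k
  have ext: "poly (pert_poly h0' st' \<theta> a k) \<mu> =
      (if k = N then (if a = j then 1 else 0) else poly (pert_poly h0 st \<theta> a k) \<mu>)" for \<theta> a k \<mu>
    by (simp add: pert_poly_def h0'_def st'_def)
  obtain f1 \<theta>1 where f1: "f1 \<in> {..<n} \<rightarrow>\<^sub>E {..<N} - {i}" "pert_minor h0 st n f1 \<theta>1 \<noteq> 0"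
    using Ci by blast
  obtain f2 where f2: "f2 \<in> {..<n} \<rightarrow>\<^sub>E insert N ({..<N} - {l})" "poly (pert_minor h0' st' n f2 \<theta>2) \<mu>2 \<noteq> 0"
    using S unfolding ext[symmetric] by (subst (asm) full_row_iff_pert_minor) auto
  define G where "G = {\<theta>. pert_minor h0 st n f1 \<theta> \<noteq> 0}"
  have "stable_under_moves UNIV G"
    unfolding stable_under_moves_def G_def by (simp add: pert_minor_nonzero_stable)
  \<comment> \<open>Both minors are made nonzero at a single \<theta>; their product then has a
    nonroot, which gives a single \<mu>.\<close>
  from stable_meets_minor[OF this _ f2(2)] f1(2)
  obtain \<theta> where th: "pert_minor h0 st n f1 \<theta> \<noteq> 0" "pert_minor h0' st' n f2 \<theta> \<noteq> 0"
    unfolding G_def by fastforce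
  then have "pert_minor h0 st n f1 \<theta> * pert_minor h0' st' n f2 \<theta> \<noteq> 0" by simp
  then obtain \<mu> where "poly (pert_minor h0 st n f1 \<theta> * pert_minor h0' st' n f2 \<theta>) \<mu> \<noteq> 0"
    using poly_all_0_iff_0 by blast
  then have \<mu>: "poly (pert_minor h0 st n f1 \<theta>) \<mu> \<noteq> 0" "poly (pert_minor h0' st' n f2 \<theta>) \<mu> \<noteq> 0" by auto
  define H where "H \<theta> a k = poly (pert_poly h0 st \<theta> a k) \<mu>" for \<theta> a k
  have full1: "full_row n ({..<N} - {i}) (H \<theta>)"
    unfolding H_def using f1(1) \<mu>(1) by (subst full_row_iff_pert_minor) auto
  have full2: "full_row n (insert N ({..<N} - {l})) (\<lambda>a k. if k = N then (if a = j then 1 else 0) else H \<theta> a k)"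
    unfolding H_def ext[symmetric] using f2(1) \<mu>(2) by (subst full_row_iff_pert_minor) auto
  have notfull: "\<not> full_row n ({..<N} - {l}) (H \<theta>')" for \<theta>'
    unfolding H_def using neg by (subst full_row_iff_pert_minor) auto
  define \<theta>' where "\<theta>' = \<theta>((j,i) := \<theta> (j,i) + 1)"
  have H': "H \<theta>' a k = H \<theta> a k + (if a = j \<and> k = i then 1 else 0)" for a k
    using j by (auto simp: H_def \<theta>'_def pert_poly_def)
  obtain q0 where q0: "\<And>k. k \<in> {..<N} - {l} \<Longrightarrow> (\<Sum>a<n. q0 a * H \<theta> a k) = 0" "\<exists>a<n. q0 a \<noteq> 0"
    using notfull[of \<theta>] unfolding full_row_def by blast
  obtain q1 where q1': "\<And>k. k \<in> {..<N} - {l} \<Longrightarrow> (\<Sum>a<n. q1 a * H \<theta>' a k) = 0" "\<exists>a<n. q1 a \<noteq> 0"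
    using notfull[of \<theta>'] unfolding full_row_def by blast
  have q1: "(\<Sum>a<n. q1 a * H \<theta> a k) = 0" if "k \<in> {..<N} - {l}" "k \<noteq> i" for k
    using q1'(1)[OF that(1)] that(2) unfolding H' by simp
  have q1i: "(\<Sum>a<n. q1 a * H \<theta> a i) + q1 j = 0"
  proof -
    have "(\<Sum>a<n. q1 a * H \<theta>' a i) = (\<Sum>a<n. q1 a * H \<theta> a i) + (\<Sum>a<n. if a = j then q1 a else 0)"
      unfolding H' sum.distrib[symmetric] by (intro sum.cong) (auto simp: algebra_simps)
    then show ?thesis using q1'(1)[of i] i j by (simp add: sum.delta)
  qed
  define c0 where "c0 = (\<Sum>a<n. q0 a * H \<theta> a l)"
  define c1 where "c1 = (\<Sum>a<n. q1 a * H \<theta> a l)"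
  \<comment> \<open>\<open>q0\<close> annihilates every column except \<open>l\<close>. If it
    annihilated \<open>l\<close> too, it would be a nonzero left kernel vector of the columns other
    than \<open>i\<close>, against \<open>full1\<close>.\<close>
  have c0: "c0 \<noteq> 0"
  proof
    assume "c0 = 0"
    then have "(\<Sum>a<n. q0 a * H \<theta> a k) = 0" if "k \<in> {..<N} - {i}" for k
      using q0(1)[of k] that unfolding c0_def by (cases "k = l") auto
    then show False using full_rowD[OF full1, of q0] q0(2) by blast
  qed
  have lin: "(\<Sum>a<n. (c1 * q0 a - c0 * q1 a) * H \<theta> a k) =
      c1 * (\<Sum>a<n. q0 a * H \<theta> a k) - c0 * (\<Sum>a<n. q1 a * H \<theta> a k)" for k
    by (simp add: sum_subtractf sum_distrib_left algebra_simps)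
  \<comment> \<open>The combination is built to cancel at column \<open>l\<close>; it annihilates
    all columns but \<open>i\<close>, so by \<open>full1\<close> it is zero and \<open>q1\<close> is
    a multiple of \<open>q0\<close>.\<close>
  have "(\<Sum>a<n. (c1 * q0 a - c0 * q1 a) * H \<theta> a k) = 0" if "k \<in> {..<N} - {i}" for k
    using q0(1)[of k] q1[of k] that unfolding lin by (cases "k = l") (auto simp: c0_def c1_def)
  then have scaled: "c1 * q0 a = c0 * q1 a" if "a < n" for a
    using full_rowD[OF full1, of "\<lambda>a. c1 * q0 a - c0 * q1 a" a] that by simp
  have "c0 * (\<Sum>a<n. q1 a * H \<theta> a i) = c1 * (\<Sum>a<n. q0 a * H \<theta> a i)"
    unfolding sum_distrib_left using scaled by (intro sum.cong) (auto simp: mult.assoc[symmetric])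
  also have "\<dots> = 0" using q0(1)[of i] i by simp
  finally have qi: "(\<Sum>a<n. q1 a * H \<theta> a i) = 0" using c0 by simp
  \<comment> \<open>\<open>q1\<close> annihilates column \<open>i\<close> both before and after the
    entry is raised by 1, and the two sums differ by \<open>q1 j\<close>.\<close>
  then have qj: "q1 j = 0" using q1i by simp
  have "q1 a = 0" if "a < n" for a
  proof (rule full_rowD[OF full2 _ that])
    fix k assume k: "k \<in> insert N ({..<N} - {l})"
    show "(\<Sum>a<n. q1 a * (if k = N then (if a = j then 1 else 0) else H \<theta> a k)) = 0"
    proof (cases "k = N")
      case True
      then show ?thesis using qj by (simp add: if_distrib sum.delta cong: if_cong)
    next
      case False
      then show ?thesis using k q1[of k] qi by (cases "k = i") auto
    qed
  qed
  then show False using q1'(2) by blast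
qed

section \<open>The Popov--Belevitch--Hautus test\<close>

definition pbh_entry :: "real mat \<Rightarrow> real mat \<Rightarrow> complex \<Rightarrow> nat \<Rightarrow> nat \<Rightarrow> complex" where
  "pbh_entry F G \<mu> a k = (let n = dim_row F in
     if k < n then (if a = k then \<mu> else 0) - of_real (F $$ (a,k)) else of_real (G $$ (a, k - n)))"

lemma sum_mult_mat_assoc:
  fixes F M :: "'a::comm_ring_1 mat"
  assumes "F \<in> carrier_mat n p" "M \<in> carrier_mat p m" "j < m"
  shows "(\<Sum>a<n. q a * (F * M) $$ (a,j)) = (\<Sum>b<p. (\<Sum>a<n. q a * F $$ (a,b)) * M $$ (b,j))"
proof -
  have "(\<Sum>a<n. q a * (F * M) $$ (a,j)) = (\<Sum>a<n. \<Sum>b<p. q a * F $$ (a,b) * M $$ (b,j))"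
    using assms by (intro sum.cong) (auto simp: scalar_prod_def sum_distrib_left atLeast0LessThan mult.assoc)
  also have "\<dots> = (\<Sum>b<p. \<Sum>a<n. q a * F $$ (a,b) * M $$ (b,j))" by (rule sum.swap)
  finally show ?thesis by (simp add: sum_distrib_right)
qed

lemma controllable_iff_annihilator:
  assumes F: "F \<in> carrier_mat n n" and G: "G \<in> carrier_mat n m"
  shows "controllable F G \<longleftrightarrow>
    (\<forall>q. (\<forall>k<n. \<forall>j<m. (\<Sum>a<n. q a * (F ^\<^sub>m k * G) $$ (a,j)) = 0) \<longrightarrow> (\<forall>a<n. q a = 0))"
proof -
  have C: "ctrb_mat F G \<in> carrier_mat n (n * m)" using F G by (simp add: ctrb_mat_def)
  have ent: "ctrb_mat F G $$ (a, j) = (F ^\<^sub>m (j div m) * G) $$ (a, j mod m)" if "a < n" "j < n * m" for a j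
    using that F G by (simp add: ctrb_mat_def)
  have "(\<forall>j\<in>{..<n*m}. (\<Sum>a<n. q a * ctrb_mat F G $$ (a,j)) = 0) \<longleftrightarrow>
      (\<forall>k<n. \<forall>j<m. (\<Sum>a<n. q a * (F ^\<^sub>m k * G) $$ (a,j)) = 0)" for q
  proof
    assume L: "\<forall>j\<in>{..<n*m}. (\<Sum>a<n. q a * ctrb_mat F G $$ (a,j)) = 0"
    show "\<forall>k<n. \<forall>j<m. (\<Sum>a<n. q a * (F ^\<^sub>m k * G) $$ (a,j)) = 0"
    proof (intro allI impI)
      fix k j assume kj: "k < n" "j < m"
      have "k * m + j < Suc k * m" using kj by simp
      also have "\<dots> \<le> n * m" using kj by (intro mult_right_mono) auto
      finally have lt: "k * m + j < n * m" .
      have dm: "(k * m + j) div m = k" "(k * m + j) mod m = j" using kj by auto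
      have "(\<Sum>a<n. q a * (F ^\<^sub>m k * G) $$ (a,j)) = (\<Sum>a<n. q a * ctrb_mat F G $$ (a, k * m + j))"
        using ent[OF _ lt, unfolded dm] by (intro sum.cong) simp_all
      then show "(\<Sum>a<n. q a * (F ^\<^sub>m k * G) $$ (a,j)) = 0" using L lt by simp
    qed
  next
    assume R: "\<forall>k<n. \<forall>j<m. (\<Sum>a<n. q a * (F ^\<^sub>m k * G) $$ (a,j)) = 0"
    show "\<forall>j\<in>{..<n*m}. (\<Sum>a<n. q a * ctrb_mat F G $$ (a,j)) = 0"
    proof
      fix j assume "j \<in> {..<n*m}"
      then have j: "j < n * m" by simp
      then have "0 < m" by (cases m) auto
      then have "j div m < n" "j mod m < m" using j by (auto simp: less_mult_imp_div_less)
      moreover have "(\<Sum>a<n. q a * ctrb_mat F G $$ (a,j)) = (\<Sum>a<n. q a * (F ^\<^sub>m (j div m) * G) $$ (a, j mod m))"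
        using ent[OF _ j] by (intro sum.cong) simp_all
      ultimately show "(\<Sum>a<n. q a * ctrb_mat F G $$ (a,j)) = 0" using R by simp
    qed
  qed
  then show ?thesis
    unfolding controllable_def using F rank_eq_dim_row_iff[OF C] by (simp add: full_row_def)
qed

text \<open>A left kernel vector of the pencil is a left eigenvector of \<open>F\<close> that
  annihilates \<open>G\<close>, hence annihilates every F^k G. Controllability speaks of real row
  vectors, so real and imaginary parts are treated separately.\<close>

lemma controllable_imp_pbh:
  assumes F: "F \<in> carrier_mat n n" and G: "G \<in> carrier_mat n m" and c: "controllable F G"
  shows "full_row n {..<n+m} (pbh_entry F G \<mu>)"
  unfolding full_row_def
proof (intro allI impI)
  fix q a assume q: "\<forall>k\<in>{..<n+m}. (\<Sum>a<n. q a * pbh_entry F G \<mu> a k) = 0" and a: "a < n"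
  have qF: "(\<Sum>a<n. q a * of_real (F $$ (a,k))) = \<mu> * q k" if "k < n" for k
  proof -
    have "(\<Sum>a<n. q a * pbh_entry F G \<mu> a k) = (\<Sum>a<n. (if a = k then \<mu> * q a else 0)) - (\<Sum>a<n. q a * of_real (F $$ (a,k)))"
      unfolding sum_subtractf[symmetric] using that F
      by (intro sum.cong) (auto simp: pbh_entry_def algebra_simps)
    then show ?thesis using q that by (simp add: sum.delta)
  qed
  have qG: "(\<Sum>a<n. q a * of_real (G $$ (a,j))) = 0" if "j < m" for j
    using q[rule_format, of "n + j"] that F by (simp add: pbh_entry_def)
  have pow: "(\<Sum>a<n. q a * of_real ((F ^\<^sub>m k * M) $$ (a,j))) = \<mu> ^ k * (\<Sum>a<n. q a * of_real (M $$ (a,j)))"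
    if "M \<in> carrier_mat n m" "j < m" for k M j
    using that
  proof (induction k arbitrary: M)
    case 0
    then show ?case using F by simp
  next
    case (Suc k)
    have FM: "F * M \<in> carrier_mat n m" using F Suc.prems by simp
    have "F ^\<^sub>m Suc k * M = F ^\<^sub>m k * (F * M)"
      using F Suc.prems by (simp add: assoc_mult_mat[of _ n n _ n _ m])
    then have "(\<Sum>a<n. q a * of_real ((F ^\<^sub>m Suc k * M) $$ (a,j))) = \<mu> ^ k * (\<Sum>a<n. q a * of_real ((F * M) $$ (a,j)))"
      using Suc.IH[OF FM Suc.prems(2)] by simp
    also have "(\<Sum>a<n. q a * of_real ((F * M) $$ (a,j))) = (\<Sum>a<n. \<Sum>b<n. q a * of_real (F $$ (a,b)) * of_real (M $$ (b,j)))"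
      using F Suc.prems by (intro sum.cong) (auto simp: scalar_prod_def sum_distrib_left atLeast0LessThan mult.assoc)
    also have "\<dots> = (\<Sum>b<n. (\<Sum>a<n. q a * of_real (F $$ (a,b))) * of_real (M $$ (b,j)))"
      unfolding sum_distrib_right by (rule sum.swap)
    also have "\<dots> = \<mu> * (\<Sum>b<n. q b * of_real (M $$ (b,j)))"
      unfolding sum_distrib_left by (intro sum.cong) (auto simp: qF)
    finally show ?case by simp
  qed
  have ann: "(\<Sum>a<n. q a * of_real ((F ^\<^sub>m k * G) $$ (a,j))) = 0" if "j < m" for k j
    using pow[OF G that, of k] qG[OF that] by simp
  have "(\<Sum>a<n. Re (q a) * (F ^\<^sub>m k * G) $$ (a,j)) = 0" if "j < m" for k j
    using arg_cong[OF ann[OF that, of k], of Re] by simp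
  then have re: "Re (q a) = 0"
    using c[unfolded controllable_iff_annihilator[OF F G], rule_format, of "\<lambda>a. Re (q a)" a] a by blast
  have "(\<Sum>a<n. Im (q a) * (F ^\<^sub>m k * G) $$ (a,j)) = 0" if "j < m" for k j
    using arg_cong[OF ann[OF that, of k], of Im] by simp
  then have "Im (q a) = 0"
    using c[unfolded controllable_iff_annihilator[OF F G], rule_format, of "\<lambda>a. Im (q a)" a] a by blast
  with re show "q a = 0" by (simp add: complex_eq_iff)
qed

text \<open>Let q be nonzero with q F^k G = 0 for k < n, and p a nonzero polynomial of least degree
  with q p(F) = 0. For a root \<mu> write p = (x - \<mu>) p'. Then q p'(F) is nonzero by minimality
  and satisfies the left eigenvector equation for \<mu>; as p' has degree below n, it also
  annihilates \<open>G\<close>.\<close>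

lemma pbh_imp_controllable:
  assumes F: "F \<in> carrier_mat n n" and G: "G \<in> carrier_mat n m"
    and full: "\<And>\<mu>. full_row n {..<n+m} (pbh_entry F G \<mu>)"
  shows "controllable F G"
proof (rule ccontr)
  assume "\<not> controllable F G"
  then obtain q where q: "\<And>k j. k < n \<Longrightarrow> j < m \<Longrightarrow> (\<Sum>a<n. q a * (F ^\<^sub>m k * G) $$ (a,j)) = 0"
    "\<exists>a<n. q a \<noteq> 0"
    unfolding controllable_iff_annihilator[OF F G] by blast
  define w where "w k b = (\<Sum>a<n. q a * (F ^\<^sub>m k) $$ (a,b))" for k b
  have Fk: "F ^\<^sub>m k \<in> carrier_mat n n" for k using F by simp
  have w0: "w 0 b = q b" if "b < n" for b
    using that F unfolding w_def by (simp add: if_distrib sum.delta cong: if_cong)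
  have wS: "w (Suc k) l = (\<Sum>b<n. w k b * F $$ (b,l))" if "l < n" for k l
    using sum_mult_mat_assoc[OF Fk F that, of q k] by (simp add: w_def)
  have wG: "(\<Sum>b<n. w k b * G $$ (b,j)) = 0" if "k < n" "j < m" for k j
    using sum_mult_mat_assoc[OF Fk G that(2), of q k] q(1)[OF that] by (simp add: w_def)
  \<comment> \<open>The row vector q p(F), for polynomials of degree at most
    \<open>n\<close>.\<close>
  define ev where "ev p b = (\<Sum>k\<le>n. coeff p k * of_real (w k b))" for p :: "complex poly" and b
  define P where "P p \<longleftrightarrow> p \<noteq> 0 \<and> degree p \<le> n \<and> (\<forall>b<n. ev p b = 0)" for p
  \<comment> \<open>The \<open>n + 1\<close> row vectors q F^k with k \<le> n live in dimension
    \<open>n\<close>, so they satisfy a linear relation.\<close>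
  have "\<exists>p. P p"
  proof -
    obtain c where c: "\<exists>k<Suc n. c k \<noteq> 0" "\<And>b. b < n \<Longrightarrow> (\<Sum>k<Suc n. c k * complex_of_real (w k b)) = 0"
      using underdetermined_system[of "{..<n}" "Suc n" "\<lambda>k b. complex_of_real (w k b)"] by auto
    define p where "p = (\<Sum>k\<le>n. monom (c k) k)"
    have cp: "coeff p k = (if k \<le> n then c k else 0)" for k
      unfolding p_def coeff_sum by (simp add: sum.delta)
    have "p \<noteq> 0" using c(1) cp by (metis coeff_0 less_Suc_eq_le)
    moreover have "degree p \<le> n" by (rule degree_le) (simp add: cp)
    moreover have "ev p b = 0" if "b < n" for b
      using c(2)[OF that] by (simp add: ev_def cp lessThan_Suc_atMost)
    ultimately show ?thesis unfolding P_def by blast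
  qed
  then obtain p where p: "P p" "\<And>p'. P p' \<Longrightarrow> degree p \<le> degree p'"
    using ex_has_least_nat[of P _ degree] by blast
  have "degree p \<noteq> 0"
  proof
    assume "degree p = 0"
    then obtain c where pc: "p = [:c:]" by (rule degree_eq_zeroE)
    then have "c \<noteq> 0" using p(1) by (auto simp: P_def)
    obtain b where b: "b < n" "q b \<noteq> 0" using q(2) by blast
    have "ev p b = c * of_real (w 0 b)"
      unfolding ev_def pc by (subst sum.atMost_shift) simp
    then show False using p(1) b \<open>c \<noteq> 0\<close> by (simp add: P_def w0)
  qed
  then obtain \<mu> where "poly p \<mu> = 0"
    using fundamental_theorem_of_algebra[of p] constant_degree by metis
  then obtain p' where pp': "p = [:-\<mu>, 1:] * p'" by (auto simp: poly_eq_0_iff_dvd dvd_def)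
  have "p' \<noteq> 0" using pp' p(1) by (auto simp: P_def)
  then have deg: "degree p = Suc (degree p')" unfolding pp' by (subst degree_mult_eq) auto
  have degn: "degree p' < n" using deg p(1) by (simp add: P_def)
  have shift: "ev p b = (\<Sum>k<n. coeff p' k * of_real (w (Suc k) b)) - \<mu> * ev p' b" for b
  proof -
    have "p = pCons 0 p' - smult \<mu> p'" unfolding pp' by simp
    then have "coeff p k = coeff (pCons 0 p') k - \<mu> * coeff p' k" for k by simp
    then have "ev p b = (\<Sum>k\<le>n. coeff (pCons 0 p') k * of_real (w k b)) - \<mu> * ev p' b"
      by (simp add: ev_def sum_subtractf sum_distrib_left left_diff_distrib mult.assoc)
    also have "(\<Sum>k\<le>n. coeff (pCons 0 p') k * of_real (w k b)) = (\<Sum>k<n. coeff p' k * of_real (w (Suc k) b))"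
      by (subst sum.atMost_shift) simp
    finally show ?thesis .
  qed
  have ev': "ev p' b = (\<Sum>k<n. coeff p' k * of_real (w k b))" for b
    using degn unfolding ev_def by (simp add: lessThan_Suc_atMost[symmetric] coeff_eq_0)
  have evF: "(\<Sum>b<n. ev p' b * of_real (M $$ (b,l))) = (\<Sum>k<n. coeff p' k * of_real (\<Sum>b<n. w k b * M $$ (b,l)))"
    for M :: "real mat" and l
  proof -
    have "(\<Sum>b<n. ev p' b * of_real (M $$ (b,l))) = (\<Sum>b<n. \<Sum>k<n. coeff p' k * (of_real (w k b) * of_real (M $$ (b,l))))"
      unfolding ev' by (simp add: sum_distrib_right mult.assoc)
    also have "\<dots> = (\<Sum>k<n. \<Sum>b<n. coeff p' k * (of_real (w k b) * of_real (M $$ (b,l))))" by (rule sum.swap)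
    finally show ?thesis by (simp add: sum_distrib_left)
  qed
  have "(\<Sum>a<n. ev p' a * pbh_entry F G \<mu> a k) = 0" if k: "k < n + m" for k
  proof (cases "k < n")
    case True
    have "(\<Sum>a<n. ev p' a * pbh_entry F G \<mu> a k) = (\<Sum>a<n. (if a = k then \<mu> * ev p' a else 0)) - (\<Sum>a<n. ev p' a * of_real (F $$ (a,k)))"
      unfolding sum_subtractf[symmetric] using True F
      by (intro sum.cong) (auto simp: pbh_entry_def algebra_simps)
    also have "(\<Sum>a<n. ev p' a * of_real (F $$ (a,k))) = (\<Sum>j<n. coeff p' j * of_real (w (Suc j) k))"
      unfolding evF using True by (simp add: wS)
    also have "\<dots> = \<mu> * ev p' k" using shift[of k] p(1) True by (simp add: P_def)
    finally show ?thesis using True by (simp add: sum.delta)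
  next
    case False
    then have "(\<Sum>a<n. ev p' a * pbh_entry F G \<mu> a k) = (\<Sum>a<n. ev p' a * of_real (G $$ (a, k - n)))"
      using F by (simp add: pbh_entry_def)
    also have "\<dots> = 0" unfolding evF using False k by (intro sum.neutral) (simp add: wG)
    finally show ?thesis .
  qed
  then have "\<forall>b<n. ev p' b = 0" using full[of \<mu>] unfolding full_row_def by blast
  then have "P p'" using \<open>p' \<noteq> 0\<close> degn by (simp add: P_def)
  then show False using p(2)[of p'] deg by simp
qed

section \<open>The perturbed system\<close>

lemma cmat_carrier [simp]: "M \<in> carrier_mat r c \<Longrightarrow> cmat M \<in> carrier_mat r c"
  by (simp add: cmat_def)

lemma cmat_index [simp]: "i < dim_row M \<Longrightarrow> j < dim_col M \<Longrightarrow> cmat M $$ (i,j) = of_real (M $$ (i,j))"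
  by (simp add: cmat_def)

lemma cmat_dims [simp]: "dim_row (cmat M) = dim_row M" "dim_col (cmat M) = dim_col M"
  by (simp_all add: cmat_def)

lemma hconcat_carrier:
  "M \<in> carrier_mat r c \<Longrightarrow> N \<in> carrier_mat r d \<Longrightarrow> hconcat M N \<in> carrier_mat r (c + d)"
  by (auto simp: hconcat_def)

lemma hconcat_index:
  assumes "M \<in> carrier_mat r c" "N \<in> carrier_mat r d" "i < r" "j < c + d"
  shows "hconcat M N $$ (i,j) = (if j < c then M $$ (i,j) else N $$ (i, j - c))"
  using assms by (auto simp: hconcat_def)

text \<open>Turns each \<open>Max\<close> of the definitions, even over infinitely many
  realizations, into an existence statement: a bounded set of naturals is finite.\<close>

lemma Max_eq_bound_iff:
  assumes "S \<noteq> {}" "\<And>x. x \<in> S \<Longrightarrow> x \<le> (b::nat)"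
  shows "Max S = b \<longleftrightarrow> b \<in> S"
proof -
  have "finite S" using assms(2) by (meson finite_nat_set_iff_bounded_le)
  then show ?thesis using assms by (metis Max_eqI Max_in)
qed

locale perturbed_system =
  fixes A B :: "real mat" and PA PB :: "bool mat" and n m :: nat
  assumes A: "A \<in> carrier_mat n n" and B: "B \<in> carrier_mat n m"
    and PA: "PA \<in> carrier_mat n n" and PB: "PB \<in> carrier_mat n m"
begin

definition base :: "nat \<Rightarrow> nat \<Rightarrow> complex poly" where
  "base a k = (if k < n then [:- of_real (A $$ (a,k)), if a = k then 1 else 0:]
     else [:of_real (B $$ (a, k - n)):])"

definition star :: "nat \<Rightarrow> nat \<Rightarrow> bool" where
  "star a k = hconcat PA PB $$ (a,k)"

lemma star_iff: "a < n \<Longrightarrow> k < n + m \<Longrightarrow> star a k = (if k < n then PA $$ (a,k) else PB $$ (a, k - n))"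
  unfolding star_def by (rule hconcat_index[OF PA PB])

definition ent :: "(nat \<times> nat \<Rightarrow> real) \<Rightarrow> complex \<Rightarrow> nat \<Rightarrow> nat \<Rightarrow> complex" where
  "ent \<theta> \<mu> a k = poly (pert_poly base star \<theta> a k) \<mu>"

abbreviation minor :: "(nat \<Rightarrow> nat) \<Rightarrow> (nat \<times> nat \<Rightarrow> real) \<Rightarrow> complex poly" where
  "minor \<equiv> pert_minor base star n"

text \<open>The sign in \<open>dA\<close> makes \<open>\<lambda>I - A - dA\<close> the entrywise sum of the unperturbed pencil and \<open>\<theta>\<close>.\<close>
definition dA :: "(nat \<times> nat \<Rightarrow> real) \<Rightarrow> real mat" where
  "dA \<theta> = mat n n (\<lambda>(a,k). if PA $$ (a,k) then - \<theta> (a,k) else 0)"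

definition dB :: "(nat \<times> nat \<Rightarrow> real) \<Rightarrow> real mat" where
  "dB \<theta> = mat n m (\<lambda>(a,k). if PB $$ (a,k) then \<theta> (a, n + k) else 0)"

lemma dA_carrier [simp]: "dA \<theta> \<in> carrier_mat n n" and dB_carrier [simp]: "dB \<theta> \<in> carrier_mat n m"
  by (simp_all add: dA_def dB_def)

lemma ent_eq_pbh_entry:
  assumes "a < n" "k < n + m"
  shows "ent \<theta> \<mu> a k = pbh_entry (A + dA \<theta>) (B + dB \<theta>) \<mu> a k"
  using assms A B by (auto simp: ent_def pert_poly_def base_def pbh_entry_def star_iff dA_def dB_def)

lemma ent_zero:
  assumes "a < n" "k < n + m"
  shows "ent (\<lambda>_. 0) \<mu> a k = (if k < n then (if a = k then \<mu> else 0) - of_real (A $$ (a,k)) else of_real (B $$ (a, k - n)))"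
  using assms by (auto simp: ent_def pert_poly_def base_def)

lemma realizations_iff:
  "M \<in> realizations PA \<and> N \<in> realizations PB \<longleftrightarrow> (\<exists>\<theta>. M = dA \<theta> \<and> N = dB \<theta>)"
proof
  assume MN: "M \<in> realizations PA \<and> N \<in> realizations PB"
  let ?t = "\<lambda>(a,k). if k < n then - M $$ (a,k) else N $$ (a, k - n)"
  have "M = dA ?t" "N = dB ?t"
    using MN PA PB by (auto intro!: eq_matI simp: realizations_def dA_def dB_def)
  then show "\<exists>\<theta>. M = dA \<theta> \<and> N = dB \<theta>" by blast
next
  assume "\<exists>\<theta>. M = dA \<theta> \<and> N = dB \<theta>"
  then show "M \<in> realizations PA \<and> N \<in> realizations PB"
    using PA PB by (auto simp: realizations_def dA_def dB_def)
qed

lemma full_row_ent_iff: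
  "full_row n {..<n+m} (ent \<theta> \<mu>) \<longleftrightarrow> full_row n {..<n+m} (pbh_entry (A + dA \<theta>) (B + dB \<theta>) \<mu>)"
  by (rule full_row_cong) (simp add: ent_eq_pbh_entry)

lemma full_row_ent_iff_minor:
  "finite K \<Longrightarrow> full_row n K (ent \<theta> \<mu>) \<longleftrightarrow> (\<exists>f \<in> {..<n} \<rightarrow>\<^sub>E K. poly (minor f \<theta>) \<mu> \<noteq> 0)"
  unfolding ent_def[abs_def] by (rule full_row_iff_pert_minor)

lemma struct_controllable_iff_parameter:
  "struct_controllable A B PA PB \<longleftrightarrow> (\<exists>\<theta>. controllable (A + dA \<theta>) (B + dB \<theta>))"
proof -
  have "struct_controllable A B PA PB \<longleftrightarrow>
      (\<exists>M N. (M \<in> realizations PA \<and> N \<in> realizations PB) \<and> controllable (A + M) (B + N))"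
    unfolding struct_controllable_def by blast
  also have "\<dots> \<longleftrightarrow> (\<exists>\<theta>. controllable (A + dA \<theta>) (B + dB \<theta>))"
    unfolding realizations_iff by blast
  finally show ?thesis .
qed

lemma struct_controllable_iff:
  "struct_controllable A B PA PB \<longleftrightarrow> (\<exists>\<theta>. \<forall>\<mu>. full_row n {..<n+m} (ent \<theta> \<mu>))"
proof -
  have c: "A + dA \<theta> \<in> carrier_mat n n" "B + dB \<theta> \<in> carrier_mat n m" for \<theta> by auto
  show ?thesis unfolding struct_controllable_iff_parameter full_row_ent_iff
    using controllable_imp_pbh[OF c] pbh_imp_controllable[OF c] by blast
qed

lemma max_pert_rank_iff:
  "max_pert_rank A B PA PB \<mu> = n \<longleftrightarrow> (\<exists>\<theta>. full_row n {..<n+m} (ent \<theta> \<mu>))"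
proof -
  define W where "W M N = hconcat (\<mu> \<cdot>\<^sub>m 1\<^sub>m n - cmat A - cmat M) (cmat (B + N))" for M N
  have W: "W (dA \<theta>) (dB \<theta>) \<in> carrier_mat n (n + m)" for \<theta>
    unfolding W_def by (rule hconcat_carrier) (auto intro!: minus_carrier_mat)
  have WE: "W (dA \<theta>) (dB \<theta>) $$ (a,k) = ent \<theta> \<mu> a k" if "a < n" "k < n + m" for \<theta> a k
  proof -
    have "W (dA \<theta>) (dB \<theta>) $$ (a,k) = (if k < n then (\<mu> \<cdot>\<^sub>m 1\<^sub>m n - cmat A - cmat (dA \<theta>)) $$ (a,k) else cmat (B + dB \<theta>) $$ (a, k - n))"
      unfolding W_def by (rule hconcat_index[OF _ _ that]) (auto intro!: minus_carrier_mat)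
    then show ?thesis using that A B
      by (auto simp: ent_eq_pbh_entry pbh_entry_def carrier_matD[OF dA_carrier] carrier_matD[OF dB_carrier])
  qed
  have rank: "vec_space.rank n (W (dA \<theta>) (dB \<theta>)) = n \<longleftrightarrow> full_row n {..<n+m} (ent \<theta> \<mu>)" for \<theta>
    unfolding rank_eq_dim_row_iff[OF W] by (rule full_row_cong) (simp add: WE)
  have "{vec_space.rank (dim_row A) (hconcat (\<mu> \<cdot>\<^sub>m 1\<^sub>m (dim_row A) - cmat A - cmat M) (cmat (B + N))) |
       M N. M \<in> realizations PA \<and> N \<in> realizations PB} = (\<lambda>\<theta>. vec_space.rank n (W (dA \<theta>) (dB \<theta>))) ` UNIV" (is "?S = ?T")
    unfolding realizations_iff W_def using A by auto
  then have "max_pert_rank A B PA PB \<mu> = Max ?T" unfolding max_pert_rank_def by simp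
  also have "Max ?T = n \<longleftrightarrow> n \<in> ?T" by (rule Max_eq_bound_iff) (auto intro: rank_le_dim_row[OF W])
  also have "\<dots> \<longleftrightarrow> (\<exists>\<theta>. full_row n {..<n+m} (ent \<theta> \<mu>))" unfolding rank[symmetric] image_iff eq_commute[of n] by simp
  finally show ?thesis .
qed

text \<open>This is why the rank condition is imposed on the spectrum of \<open>A\<close> alone:
  elsewhere the unperturbed square block is already invertible.\<close>

lemma noneigenvalue_full_row:
  assumes "\<not> eigenvalue (cmat A) \<mu>"
  shows "full_row n {..<n} (ent (\<lambda>_. 0) \<mu>)"
proof -
  have cA: "cmat A \<in> carrier_mat n n" using A by simp
  have "det (char_matrix (cmat A) \<mu>) \<noteq> 0" using assms eigenvalue_det[OF cA] by simp
  moreover have "char_matrix (cmat A) \<mu> \<in> carrier_mat n n" using cA by auto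
  ultimately have "det (- char_matrix (cmat A) \<mu>) \<noteq> 0" by (simp add: det_0_negate)
  moreover have "- char_matrix (cmat A) \<mu> = mat n n (\<lambda>(a,b). ent (\<lambda>_. 0) \<mu> a ((\<lambda>b. b) b))"
    using A by (intro eq_matI) (auto simp: char_matrix_def ent_zero)
  ultimately have "full_row n ((\<lambda>b. b) ` {..<n}) (ent (\<lambda>_. 0) \<mu>)"
    unfolding det_neq_0_iff_full_row[symmetric] by simp
  then show ?thesis by simp
qed

lemma finite_eigenvalues: "finite {\<mu>. eigenvalue (cmat A) \<mu>}"
proof -
  have cA: "cmat A \<in> carrier_mat n n" using A by simp
  have "char_poly (cmat A) \<noteq> 0" using degree_monic_char_poly[OF cA] by auto
  then show ?thesis unfolding eigenvalue_root_char_poly[OF cA] by (rule poly_roots_finite)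
qed

text \<open>Algebraic counterpart of input-reachability of \<open>Z i\<close>: column
  \<open>i\<close> is then a rational combination of the others, so the pencil has a kernel vector,
  made of state and input, with nonzero entry at \<open>i\<close>.\<close>

definition avoidable :: "nat \<Rightarrow> bool" where
  "avoidable i \<longleftrightarrow> (\<exists>\<theta>. \<exists>f \<in> {..<n} \<rightarrow>\<^sub>E {..<n+m} - {i}. minor f \<theta> \<noteq> 0)"

lemma avoidableI: "full_row n ({..<n+m} - {i}) (ent \<theta> \<mu>) \<Longrightarrow> avoidable i"
proof -
  assume "full_row n ({..<n+m} - {i}) (ent \<theta> \<mu>)"
  then obtain f where f: "f \<in> {..<n} \<rightarrow>\<^sub>E {..<n+m} - {i}" "poly (minor f \<theta>) \<mu> \<noteq> 0"
    by (subst (asm) full_row_ent_iff_minor) auto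
  have "minor f \<theta> \<noteq> 0" using f(2) by (rule contrapos_nn) simp
  with f(1) show ?thesis unfolding avoidable_def by blast
qed

text \<open>The hypothesis says q (\<mu>I - A) = c e_l for some c. Multiplying by \<open>R\<close>
  from the right gives c times row \<open>l\<close> of \<open>R\<close>.\<close>

lemma resolvent_left_kernel:
  assumes R: "R \<in> carrier_mat n n" "R * (\<mu> \<cdot>\<^sub>m 1\<^sub>m n - cmat A) = 1\<^sub>m n" and l: "l < n"
    and q: "\<And>k. k < n \<Longrightarrow> k \<noteq> l \<Longrightarrow> (\<Sum>a<n. q a * ent (\<lambda>_. 0) \<mu> a k) = 0"
  obtains c where "\<And>b. b < n \<Longrightarrow> q b = c * R $$ (l,b)"
proof -
  let ?M = "\<mu> \<cdot>\<^sub>m 1\<^sub>m n - cmat A"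
  have M: "?M \<in> carrier_mat n n" using A by (auto intro!: minus_carrier_mat)
  have ME: "?M $$ (a,k) = ent (\<lambda>_. 0) \<mu> a k" if "a < n" "k < n" for a k
    using that A by (auto simp: ent_zero)
  have MR: "?M * R = 1\<^sub>m n" by (rule mat_mult_left_right_inverse[OF R(1) M R(2)])
  let ?c = "\<Sum>a<n. q a * ent (\<lambda>_. 0) \<mu> a l"
  have "q b = ?c * R $$ (l,b)" if b: "b < n" for b
  proof -
    have "q b = (\<Sum>a<n. if a = b then q a else 0)" using b by (simp add: sum.delta)
    also have "\<dots> = (\<Sum>a<n. q a * (?M * R) $$ (a,b))"
      unfolding MR using b by (intro sum.cong) auto
    also have "\<dots> = (\<Sum>k<n. (\<Sum>a<n. q a * ?M $$ (a,k)) * R $$ (k,b))"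
      by (rule sum_mult_mat_assoc[OF M R(1) b])
    also have "\<dots> = (\<Sum>k<n. (\<Sum>a<n. q a * ent (\<lambda>_. 0) \<mu> a k) * R $$ (k,b))"
      by (intro sum.cong refl arg_cong2[of _ _ _ _ times]) (auto simp del: index_minus_mat simp: ME)
    also have "\<dots> = (\<Sum>k<n. if k = l then ?c * R $$ (l,b) else 0)"
      using q by (intro sum.cong) auto
    also have "\<dots> = ?c * R $$ (l,b)" using l by (simp add: sum.delta)
    finally show ?thesis .
  qed
  then show thesis using that by blast
qed

text \<open>At \<theta> = 0, a vector annihilating all state columns but \<open>l\<close> is c times
  row \<open>l\<close> of the resolvent; annihilating input column \<open>n + j\<close> then means c
  (R B)_lj = 0.\<close>

lemma avoidable_of_input_edge:
  assumes l: "l < n" and j: "j < m" and nz: "resolvent_entry_nz A B l j"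
  shows "avoidable l"
proof -
  obtain \<mu> R where R: "R \<in> carrier_mat n n" "R * (\<mu> \<cdot>\<^sub>m 1\<^sub>m n - cmat A) = 1\<^sub>m n"
    and nz: "(R * cmat B) $$ (l,j) \<noteq> 0"
    using nz A unfolding resolvent_entry_nz_def by auto
  have RB: "(R * cmat B) $$ (l,j) = (\<Sum>b<n. R $$ (l,b) * of_real (B $$ (b,j)))"
    using R(1) B l j by (simp add: scalar_prod_def atLeast0LessThan)
  have "full_row n ({..<n+m} - {l}) (ent (\<lambda>_. 0) \<mu>)"
    unfolding full_row_def
  proof (intro allI impI)
    fix q a assume q: "\<forall>k\<in>{..<n+m} - {l}. (\<Sum>a<n. q a * ent (\<lambda>_. 0) \<mu> a k) = 0" and a: "a < n"
    obtain c where c: "\<And>b. b < n \<Longrightarrow> q b = c * R $$ (l,b)"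
      by (rule resolvent_left_kernel[OF R l, of q]) (use q in auto)
    have "0 = (\<Sum>b<n. q b * ent (\<lambda>_. 0) \<mu> b (n + j))" using q j l by simp
    also have "\<dots> = c * (\<Sum>b<n. R $$ (l,b) * of_real (B $$ (b,j)))"
      unfolding sum_distrib_left using j by (intro sum.cong) (auto simp: ent_zero c)
    finally have "c = 0" using nz RB by simp
    then show "q a = 0" using c a by simp
  qed
  then show ?thesis by (rule avoidableI)
qed

lemma avoidable_of_input_column:
  assumes "n \<le> l"
  shows "avoidable l"
proof -
  obtain \<mu> where "\<not> eigenvalue (cmat A) \<mu>"
    using ex_new_if_finite[OF infinite_UNIV_char_0 finite_eigenvalues] by blast
  from noneigenvalue_full_row[OF this]
  have "full_row n ({..<n+m} - {l}) (ent (\<lambda>_. 0) \<mu>)"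
    by (rule full_row_mono) (use assms in auto)
  then show ?thesis by (rule avoidableI)
qed

text \<open>Treats the two edges from \<open>Z i\<close> through \<open>X j\<close> to
  \<open>Z l\<close> at once. The resolvent entry shows that an extra input column e_j would make
  \<open>l\<close> avoidable; the free entry at (j,i) in the avoidable column \<open>i\<close> takes
  the part of that input.\<close>

lemma avoidable_of_state_edge:
  assumes l: "l < n" and j: "j < n" and nz: "resolvent_entry_nz A (1\<^sub>m n) l j"
    and i: "i < n + m" "star j i" "avoidable i"
  shows "avoidable l"
proof (cases "i = l")
  case False
  obtain \<mu> R where R: "R \<in> carrier_mat n n" "R * (\<mu> \<cdot>\<^sub>m 1\<^sub>m n - cmat A) = 1\<^sub>m n"
    and nz: "(R * cmat (1\<^sub>m n)) $$ (l,j) \<noteq> 0"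
    using nz A unfolding resolvent_entry_nz_def by auto
  have "cmat (1\<^sub>m n) = 1\<^sub>m n" by (auto simp: cmat_def intro!: eq_matI)
  then have Rlj: "R $$ (l,j) \<noteq> 0" using nz R(1) by simp
  have "full_row n (insert (n+m) ({..<n+m} - {l}))
      (\<lambda>a k. if k = n + m then (if a = j then 1 else 0) else poly (pert_poly base star (\<lambda>_. 0) a k) \<mu>)"
    unfolding full_row_def
  proof (intro allI impI)
    fix q a assume q: "\<forall>k\<in>insert (n+m) ({..<n+m} - {l}). (\<Sum>a<n. q a *
      (if k = n + m then (if a = j then 1 else 0) else poly (pert_poly base star (\<lambda>_. 0) a k) \<mu>)) = 0" and a: "a < n"
    have q': "(\<Sum>a<n. q a * ent (\<lambda>_. 0) \<mu> a k) = 0" if "k < n" "k \<noteq> l" for k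
      using q[rule_format, of k] that by (simp add: ent_def)
    obtain c where c: "\<And>b. b < n \<Longrightarrow> q b = c * R $$ (l,b)"
      by (rule resolvent_left_kernel[OF R l, of q]) (use q' in auto)
    have "(\<Sum>a<n. q a * (if a = j then 1 else 0)) = 0" using q[rule_format, of "n + m"] by simp
    then have "q j = 0" using j by (simp add: if_distrib sum.delta cong: if_cong)
    then have "c = 0" using c[OF j] Rlj by simp
    then show "q a = 0" using c a by simp
  qed
  from avoiding_minor_step[OF i(1) False j i(2) i(3)[unfolded avoidable_def] this]
  show ?thesis unfolding avoidable_def .
qed (use i in simp)

lemma reachable_imp_avoidable:
  assumes "input_reachable A B PA PB (Z i)" "i < n + m"
  shows "avoidable i"
proof -
  \<comment> \<open>State vertices have no avoidability of their own. The predicate at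
    \<open>X j\<close> remembers an edge from an avoidable \<open>Z i\<close>, to be combined with
    the edge that leaves \<open>X j\<close>.\<close>
  define Q where "Q v = (case v of Z l \<Rightarrow> avoidable l
      | X j \<Rightarrow> j < n \<and> (\<exists>i < n + m. star j i \<and> avoidable i) | U _ \<Rightarrow> True)" for v
  obtain j where "(U j, Z i) \<in> (acg_edges A B PA PB)\<^sup>*"
    using assms(1) unfolding input_reachable_def by blast
  then have "Q (Z i)"
  proof (induction rule: rtrancl_induct)
    case base
    then show ?case by (simp add: Q_def)
  next
    case (step v w)
    from step.hyps(2) consider "(v,w) \<in> E_xz A B" | "(v,w) \<in> E_uz A B" | "(v,w) \<in> E_zx PA PB"
      unfolding acg_edges_def by blast
    then show ?case
    proof cases
      case 1
      then obtain j l where vw: "v = X j" "w = Z l" "j < n" "l < n" "resolvent_entry_nz A (1\<^sub>m n) l j"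
        using A unfolding E_xz_def by (auto simp: Let_def)
      then show ?thesis using step.IH avoidable_of_state_edge unfolding Q_def by auto
    next
      case 2
      then obtain j l where vw: "v = U j" "w = Z l" "j < m" "l < n \<Longrightarrow> resolvent_entry_nz A B l j"
        using A B unfolding E_uz_def by (auto simp: Let_def split: if_splits)
      then show ?thesis using avoidable_of_input_edge[of l j] avoidable_of_input_column[of l]
        unfolding Q_def by (cases "l < n") auto
    next
      case 3
      then obtain j i where vw: "v = Z i" "w = X j" "i < n + m" "j < n" "star j i"
        using PA PB unfolding E_zx_def star_def by auto
      then show ?thesis using step.IH unfolding Q_def by auto
    qed
  qed
  then show ?thesis by (simp add: Q_def)
qed

lemma struct_controllableI:
  assumes ev: "\<And>\<mu>. eigenvalue (cmat A) \<mu> \<Longrightarrow> \<exists>\<theta>. full_row n {..<n+m} (ent \<theta> \<mu>)"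
    and reach: "\<And>i. i < n + m \<Longrightarrow> input_reachable A B PA PB (Z i)"
  shows "struct_controllable A B PA PB"
  unfolding struct_controllable_iff full_row_ent_iff_minor[OF finite_lessThan]
proof (rule generic_full_row)
  show "\<exists>\<theta>. \<exists>f \<in> {..<n} \<rightarrow>\<^sub>E {..<n+m} - {i}. minor f \<theta> \<noteq> 0" if "i < n + m" for i
    using reachable_imp_avoidable[OF reach[OF that] that] unfolding avoidable_def .
  show "\<exists>\<theta>. \<exists>f \<in> {..<n} \<rightarrow>\<^sub>E {..<n+m}. poly (minor f \<theta>) \<mu> \<noteq> 0" for \<mu>
    unfolding full_row_ent_iff_minor[OF finite_lessThan, symmetric]
    using ev full_row_mono[OF noneigenvalue_full_row[of \<mu>], of "{..<n+m}"]
    by (cases "eigenvalue (cmat A) \<mu>") auto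
qed

end

section \<open>Necessity of input-reachability\<close>

lemma index_mult_mat_sum:
  assumes "F \<in> carrier_mat n p" "M \<in> carrier_mat p m" "a < n" "j < m"
  shows "(F * M) $$ (a,j) = (\<Sum>b<p. F $$ (a,b) * M $$ (b,j))"
  using assms by (auto simp: scalar_prod_def atLeast0LessThan)

lemma pow_mat_commute:
  fixes F :: "'a::comm_ring_1 mat"
  assumes F: "F \<in> carrier_mat n n"
  shows "F * F ^\<^sub>m k = F ^\<^sub>m k * F"
proof (induction k)
  case 0
  then show ?case using F by simp
next
  case (Suc k)
  have Fk: "F ^\<^sub>m k \<in> carrier_mat n n" using F by simp
  have "F * F ^\<^sub>m Suc k = F * F ^\<^sub>m k * F"
    using assoc_mult_mat[OF F Fk F] by simp
  then show ?case using Suc by simp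
qed

text \<open>Quantifies that the resolvent tends to zero at infinity.\<close>

lemma decaying_solution_bound:
  fixes x :: "nat \<Rightarrow> complex"
  assumes eq: "\<And>a. a < n \<Longrightarrow> of_real t * x a = (\<Sum>b<n. of_real (M a b) * x b) + of_real (r a)"
    and t: "(\<Sum>a<n. \<Sum>b<n. \<bar>M a b\<bar>) < t"
  shows "(t - (\<Sum>a<n. \<Sum>b<n. \<bar>M a b\<bar>)) * (\<Sum>a<n. cmod (x a)) \<le> (\<Sum>a<n. \<bar>r a\<bar>)"
proof -
  let ?s = "\<Sum>a<n. cmod (x a)" and ?M = "\<Sum>a<n. \<Sum>b<n. \<bar>M a b\<bar>"
  have "0 \<le> ?M" by (intro sum_nonneg) auto
  then have t0: "0 \<le> t" using t by linarith
  have xs: "cmod (x b) \<le> ?s" if "b < n" for b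
    using that by (intro member_le_sum) auto
  have "t * cmod (x a) \<le> (\<Sum>b<n. \<bar>M a b\<bar>) * ?s + \<bar>r a\<bar>" if "a < n" for a
  proof -
    have "t * cmod (x a) = cmod (of_real t * x a)" using t0 by (simp add: norm_mult)
    also have "\<dots> \<le> cmod (\<Sum>b<n. of_real (M a b) * x b) + \<bar>r a\<bar>"
      unfolding eq[OF that] using norm_triangle_ineq[of _ "of_real (r a) :: complex"] by simp
    also have "cmod (\<Sum>b<n. of_real (M a b) * x b) \<le> (\<Sum>b<n. \<bar>M a b\<bar> * ?s)"
      using xs by (intro sum_norm_le) (auto simp: norm_mult intro!: mult_left_mono)
    finally show ?thesis by (simp add: sum_distrib_right)
  qed
  then have "(\<Sum>a<n. t * cmod (x a)) \<le> (\<Sum>a<n. (\<Sum>b<n. \<bar>M a b\<bar>) * ?s + \<bar>r a\<bar>)"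
    by (intro sum_mono) auto
  also have "\<dots> = ?M * ?s + (\<Sum>a<n. \<bar>r a\<bar>)" by (simp add: sum.distrib sum_distrib_right)
  finally show ?thesis by (simp add: sum_distrib_left[symmetric] left_diff_distrib)
qed

context perturbed_system
begin

lemma resolvent_exists:
  assumes "\<not> eigenvalue (cmat A) \<mu>"
  obtains R where "R \<in> carrier_mat n n" "R * (\<mu> \<cdot>\<^sub>m 1\<^sub>m n - cmat A) = 1\<^sub>m n"
    "(\<mu> \<cdot>\<^sub>m 1\<^sub>m n - cmat A) * R = 1\<^sub>m n"
proof -
  let ?M = "\<mu> \<cdot>\<^sub>m 1\<^sub>m n - cmat A"
  have M: "?M \<in> carrier_mat n n" using A by (auto intro!: minus_carrier_mat)
  have "?M = mat n n (\<lambda>(a,b). ent (\<lambda>_. 0) \<mu> a ((\<lambda>b. b) b))"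
    using A by (intro eq_matI) (auto simp: ent_zero)
  then have "det ?M \<noteq> 0"
    using noneigenvalue_full_row[OF assms] det_neq_0_iff_full_row[of n "ent (\<lambda>_. 0) \<mu>" "\<lambda>b. b"] by simp
  then have "?M \<in> Units (ring_mat TYPE(complex) n ())" by (rule det_non_zero_imp_unit[OF M])
  then show thesis using that unfolding Units_def by (auto simp: ring_mat_def)
qed

lemma exists_large_noneigenvalue: "\<exists>t>T. \<not> eigenvalue (cmat A) (of_real t)"
proof (rule ccontr)
  assume "\<not> ?thesis"
  then have "complex_of_real ` {T<..} \<subseteq> {\<mu>. eigenvalue (cmat A) \<mu>}" by auto
  then have "finite (complex_of_real ` {T<..})" using finite_eigenvalues by (rule finite_subset)
  then have "finite {T<..}" by (rule finite_imageD) (auto simp: inj_on_def)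
  then show False by (simp add: infinite_Ioi)
qed

text \<open>The A^k M are the coefficients of the resolvent times \<open>M\<close> at infinity, and
  they are peeled off one by one. With x the column \<open>j\<close> of that product, the functions
  f k = (A^k x)_i satisfy f (k+1) = \<mu> f k - (A^k M)_ij. If f k vanishes, f (k+1) is constant,
  and the decay of x for large real \<mu> makes the constant 0.\<close>

lemma resolvent_zero_imp_power_zero:
  assumes M: "M \<in> carrier_mat n p" and i: "i < n" and j: "j < p"
    and zero: "\<not> resolvent_entry_nz A M i j"
  shows "(A ^\<^sub>m k * M) $$ (i,j) = 0"
proof -
  have Ak: "A ^\<^sub>m k \<in> carrier_mat n n" for k using A by simp
  \<comment> \<open>Placing the guard inside the quantifier lets one choice function
    \<open>x\<close> be total in \<mu>.\<close>
  have "\<exists>x. \<not> eigenvalue (cmat A) \<mu> \<longrightarrow> x i = 0 \<and>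
      (\<forall>a<n. \<mu> * x a = (\<Sum>b<n. of_real (A $$ (a,b)) * x b) + of_real (M $$ (a,j)))" for \<mu>
  proof (cases "eigenvalue (cmat A) \<mu>")
    case False
    let ?N = "\<mu> \<cdot>\<^sub>m 1\<^sub>m n - cmat A"
    obtain R where R: "R \<in> carrier_mat n n" "R * ?N = 1\<^sub>m n" "?N * R = 1\<^sub>m n"
      by (rule resolvent_exists[OF False])
    have N: "?N \<in> carrier_mat n n" using A by (auto intro!: minus_carrier_mat)
    have cM: "cmat M \<in> carrier_mat n p" using M by simp
    have RM: "R * cmat M \<in> carrier_mat n p" using R(1) cM by simp
    define x where "x b = (R * cmat M) $$ (b,j)" for b
    have "x i = 0" using zero R(1,2) A unfolding resolvent_entry_nz_def x_def by auto
    moreover have "\<mu> * x a = (\<Sum>b<n. of_real (A $$ (a,b)) * x b) + of_real (M $$ (a,j))" if a: "a < n" for a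
    proof -
      have "?N * (R * cmat M) = cmat M"
        using assoc_mult_mat[OF N R(1) cM] R(3) left_mult_one_mat[OF cM] by simp
      then have "of_real (M $$ (a,j)) = (?N * (R * cmat M)) $$ (a,j)" using M a j by simp
      also have "\<dots> = (\<Sum>b<n. ?N $$ (a,b) * x b)"
        unfolding x_def by (rule index_mult_mat_sum[OF N RM a j])
      also have "\<dots> = (\<Sum>b<n. (if b = a then \<mu> * x b else 0) - of_real (A $$ (a,b)) * x b)"
        using A a by (intro sum.cong) (auto simp: algebra_simps)
      also have "\<dots> = \<mu> * x a - (\<Sum>b<n. of_real (A $$ (a,b)) * x b)"
        using a by (simp add: sum_subtractf sum.delta)
      finally show ?thesis by simp
    qed
    ultimately show ?thesis by blast
  qed simp
  then obtain x where xi: "\<And>\<mu>. \<not> eigenvalue (cmat A) \<mu> \<Longrightarrow> x \<mu> i = 0"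
    and x: "\<And>\<mu> a. \<not> eigenvalue (cmat A) \<mu> \<Longrightarrow> a < n \<Longrightarrow>
        \<mu> * x \<mu> a = (\<Sum>b<n. of_real (A $$ (a,b)) * x \<mu> b) + of_real (M $$ (a,j))" by metis
  define f where "f k \<mu> = (\<Sum>b<n. of_real ((A ^\<^sub>m k) $$ (i,b)) * x \<mu> b)" for k \<mu>
  have fS: "f (Suc k) \<mu> = \<mu> * f k \<mu> - of_real ((A ^\<^sub>m k * M) $$ (i,j))" if ev: "\<not> eigenvalue (cmat A) \<mu>" for k \<mu>
  proof -
    have "f (Suc k) \<mu> = (\<Sum>b<n. \<Sum>c<n. of_real ((A ^\<^sub>m k) $$ (i,c)) * (of_real (A $$ (c,b)) * x \<mu> b))"
      unfolding f_def using A i Ak[of k]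
      by (intro sum.cong) (auto simp: scalar_prod_def sum_distrib_right atLeast0LessThan mult.assoc)
    also have "\<dots> = (\<Sum>c<n. of_real ((A ^\<^sub>m k) $$ (i,c)) * (\<Sum>b<n. of_real (A $$ (c,b)) * x \<mu> b))"
      unfolding sum_distrib_left by (rule sum.swap)
    also have "\<dots> = (\<Sum>c<n. of_real ((A ^\<^sub>m k) $$ (i,c)) * (\<mu> * x \<mu> c - of_real (M $$ (c,j))))"
      using x[OF ev] by (intro sum.cong) auto
    also have "\<dots> = \<mu> * f k \<mu> - of_real (\<Sum>c<n. (A ^\<^sub>m k) $$ (i,c) * M $$ (c,j))"
      unfolding f_def by (simp add: right_diff_distrib sum_subtractf sum_distrib_left mult.left_commute)
    also have "(\<Sum>c<n. (A ^\<^sub>m k) $$ (i,c) * M $$ (c,j)) = (A ^\<^sub>m k * M) $$ (i,j)"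
      by (rule index_mult_mat_sum[OF Ak M i j, symmetric])
    finally show ?thesis .
  qed
  define \<alpha> where "\<alpha> = (\<Sum>a<n. \<Sum>b<n. \<bar>A $$ (a,b)\<bar>)"
  define \<beta> where "\<beta> = (\<Sum>a<n. \<bar>M $$ (a,j)\<bar>)"
  have step: "(A ^\<^sub>m k * M) $$ (i,j) = 0" if fk: "\<And>\<mu>. \<not> eigenvalue (cmat A) \<mu> \<Longrightarrow> f k \<mu> = 0" for k
  proof (rule ccontr)
    define c where "c = (A ^\<^sub>m k * M) $$ (i,j)"
    assume "(A ^\<^sub>m k * M) $$ (i,j) \<noteq> 0"
    then have c: "\<bar>c\<bar> > 0" by (simp add: c_def)
    define \<gamma> where "\<gamma> = (\<Sum>b<n. \<bar>(A ^\<^sub>m Suc k) $$ (i,b)\<bar>)"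
    have nonneg: "0 \<le> \<alpha>" "0 \<le> \<beta>" "0 \<le> \<gamma>" by (simp_all add: \<alpha>_def \<beta>_def \<gamma>_def sum_nonneg)
    \<comment> \<open>Beyond this threshold the decay bound (t - \<alpha>) s \<le> \<beta> gives
      \<gamma> s < |c|, whereas |c| is the modulus of f (k+1), at most \<gamma> s.\<close>
    obtain t where t: "t > \<alpha> + \<gamma> * \<beta> / \<bar>c\<bar>" "\<not> eigenvalue (cmat A) (of_real t)"
      using exists_large_noneigenvalue by blast
    have "0 \<le> \<gamma> * \<beta> / \<bar>c\<bar>" using nonneg by simp
    then have ta: "\<alpha> < t" using t(1) by linarith
    let ?s = "\<Sum>a<n. cmod (x (of_real t) a)"
    have s: "(t - \<alpha>) * ?s \<le> \<beta>"
      unfolding \<alpha>_def \<beta>_def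
      by (rule decaying_solution_bound[where M = "\<lambda>a b. A $$ (a,b)" and r = "\<lambda>a. M $$ (a,j)"])
         (use x[OF t(2)] ta in \<open>auto simp: \<alpha>_def\<close>)
    have "f (Suc k) (of_real t) = - of_real c" using fS[OF t(2), of k] fk[OF t(2)] by (simp add: c_def)
    then have "\<bar>c\<bar> = cmod (f (Suc k) (of_real t))" by simp
    also have "\<dots> \<le> (\<Sum>b<n. \<bar>(A ^\<^sub>m Suc k) $$ (i,b)\<bar> * ?s)"
      unfolding f_def
      by (intro sum_norm_le) (auto simp: norm_mult simp del: pow_mat.simps intro!: mult_left_mono member_le_sum)
    also have "\<dots> = \<gamma> * ?s" by (simp add: \<gamma>_def sum_distrib_right)
    finally have "\<bar>c\<bar> * (t - \<alpha>) \<le> \<gamma> * ?s * (t - \<alpha>)" using ta by (intro mult_right_mono) auto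
    also have "\<dots> = \<gamma> * ((t - \<alpha>) * ?s)" by simp
    also have "\<dots> \<le> \<gamma> * \<beta>" by (rule mult_left_mono[OF s nonneg(3)])
    finally have "t - \<alpha> \<le> \<gamma> * \<beta> / \<bar>c\<bar>"
      by (simp only: pos_le_divide_eq[OF c] mult.commute[of "t - \<alpha>"])
    then show False using t(1) by linarith
  qed
  have "\<not> eigenvalue (cmat A) \<mu> \<Longrightarrow> f k \<mu> = 0" for k \<mu>
  proof (induction k arbitrary: \<mu>)
    case 0
    have "f 0 \<mu> = (\<Sum>b<n. if b = i then x \<mu> b else 0)"
      unfolding f_def using A i by (intro sum.cong) auto
    then show ?case using i xi[OF 0] by (simp add: sum.delta)
  next
    case (Suc k)
    then show ?case using fS[OF Suc.prems, of k] step[of k] by simp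
  qed
  then show ?thesis by (rule step)
qed

section \<open>Unreachable vertices as an obstruction to controllability\<close>

lemma input_reachable_step:
  "input_reachable A B PA PB v \<Longrightarrow> (v,w) \<in> acg_edges A B PA PB \<Longrightarrow> input_reachable A B PA PB w"
  unfolding input_reachable_def by (meson rtrancl.rtrancl_into_rtrancl)

lemma input_column_reachable:
  assumes "n \<le> k" "k < n + m"
  shows "input_reachable A B PA PB (Z k)"
proof -
  have "(U (k - n), Z k) \<in> acg_edges A B PA PB"
    using assms A B by (auto simp: acg_edges_def E_uz_def Let_def)
  moreover have "input_reachable A B PA PB (U (k - n))"
    using assms B unfolding input_reachable_def by (intro exI[of _ "k - n"]) auto
  ultimately show ?thesis using input_reachable_step by blast
qed

text \<open>The span of the unreachable unit vectors need not be invariant: e_s A may be nonzero at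
  a state whose \<open>Z\<close> vertex is reachable but whose \<open>X\<close> vertex is not.
  \<open>S\<close> and \<open>T\<close> keep the two kinds of unreachability apart. Rows of every
  A^k with index in \<open>S\<close> vanish outside \<open>T\<close>, and the perturbation sends row
  vectors supported on \<open>T\<close> back to row vectors supported on \<open>S\<close>.\<close>

lemma struct_controllable_imp_reachable:
  assumes sc: "struct_controllable A B PA PB" and i: "i < n + m"
  shows "input_reachable A B PA PB (Z i)"
proof (rule ccontr)
  let ?r = "input_reachable A B PA PB"
  assume neg: "\<not> ?r (Z i)"
  have rU: "?r (U j)" if "j < m" for j using that B unfolding input_reachable_def by auto
  have in0: "i < n" using input_column_reachable[of i] neg i by force
  define S where "S = {s. s < n \<and> \<not> ?r (Z s)}"
  define T where "T = {j. j < n \<and> \<not> ?r (X j)}"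
  have SB: "(A ^\<^sub>m k * B) $$ (s,j) = 0" if "s \<in> S" "j < m" for s j k
  proof (rule resolvent_zero_imp_power_zero[OF B _ that(2)])
    show "s < n" using that by (simp add: S_def)
    show "\<not> resolvent_entry_nz A B s j"
    proof
      assume "resolvent_entry_nz A B s j"
      then have "(U j, Z s) \<in> acg_edges A B PA PB" using that A B
        by (auto simp: S_def acg_edges_def E_uz_def Let_def)
      then show False using input_reachable_step[OF rU[of j]] that by (auto simp: S_def)
    qed
  qed
  have SA: "(A ^\<^sub>m k) $$ (s,j) = 0" if "s \<in> S" "j < n" "j \<notin> T" for s j k
  proof -
    have "(A ^\<^sub>m k * 1\<^sub>m n) $$ (s,j) = 0"
    proof (rule resolvent_zero_imp_power_zero[OF _ _ that(2)])
      show "s < n" using that by (simp add: S_def)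
      show "\<not> resolvent_entry_nz A (1\<^sub>m n) s j"
      proof
        assume "resolvent_entry_nz A (1\<^sub>m n) s j"
        then have "(X j, Z s) \<in> acg_edges A B PA PB" using that A B
          by (auto simp: S_def acg_edges_def E_xz_def Let_def)
        then show False using input_reachable_step[of "X j" "Z s"] that by (auto simp: S_def T_def)
      qed
    qed simp
    then show ?thesis using right_mult_one_mat[of "A ^\<^sub>m k" n n] A by simp
  qed
  have TS: "k \<in> S" if "j \<in> T" "k < n + m" "star j k" for j k
  proof -
    have "(Z k, X j) \<in> acg_edges A B PA PB" using that PA PB
      by (auto simp: T_def acg_edges_def E_zx_def star_def)
    then have "\<not> ?r (Z k)" using input_reachable_step[of "Z k" "X j"] that by (auto simp: T_def)
    then show ?thesis using input_column_reachable[of k] that by (auto simp: S_def not_le[symmetric])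
  qed
  obtain \<theta> where ctrl: "controllable (A + dA \<theta>) (B + dB \<theta>)"
    using sc unfolding struct_controllable_iff_parameter by blast
  let ?A = "A + dA \<theta>" and ?B = "B + dB \<theta>"
  have A': "?A \<in> carrier_mat n n" and B': "?B \<in> carrier_mat n m" by auto
  have AE: "?A $$ (a,b) = A $$ (a,b) + dA \<theta> $$ (a,b)" if "a < n" "b < n" for a b
    using that carrier_matD[OF dA_carrier[of \<theta>]] by simp
  have BE: "?B $$ (a,b) = B $$ (a,b) + dB \<theta> $$ (a,b)" if "a < n" "b < m" for a b
    using that carrier_matD[OF dB_carrier[of \<theta>]] by simp
  have dA0: "dA \<theta> $$ (a,b) = 0" if "a \<in> T" "b < n" "b \<notin> S" for a b
    using TS[of a b] that star_iff[of a b] by (auto simp: T_def dA_def)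
  have dB0: "dB \<theta> $$ (a,b) = 0" if "a \<in> T" "b < m" for a b
    using TS[of a "n + b"] that star_iff[of a "n + b"] by (auto simp: T_def S_def dB_def)
  \<comment> \<open>A space of row vectors containing the unreachable unit vectors, invariant under the perturbed
    \<open>A\<close> and annihilating the perturbed \<open>B\<close>.\<close>
  define W where "W = {w. \<forall>k. (\<forall>j<m. (\<Sum>a<n. w a * (A ^\<^sub>m k * B) $$ (a,j)) = 0) \<and>
      (\<forall>j<n. j \<notin> T \<longrightarrow> (\<Sum>a<n. w a * (A ^\<^sub>m k) $$ (a,j)) = 0)}"
  have W_B: "(\<Sum>a<n. w a * (A ^\<^sub>m k * B) $$ (a,j)) = 0" if "w \<in> W" "j < m" for w k j
    using that unfolding W_def by blast
  have W_pow: "(\<Sum>a<n. w a * (A ^\<^sub>m k) $$ (a,j)) = 0" if "w \<in> W" "j < n" "j \<notin> T" for w k j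
    using that unfolding W_def by blast
  have W_T: "w a = 0" if "w \<in> W" "a < n" "a \<notin> T" for w a
  proof -
    have "(\<Sum>c<n. w c * (A ^\<^sub>m 0) $$ (c,a)) = 0" by (rule W_pow[OF that])
    moreover have "(\<Sum>c<n. w c * (A ^\<^sub>m 0) $$ (c,a)) = (\<Sum>c<n. if c = a then w c else 0)"
      using that A by (intro sum.cong) auto
    ultimately show ?thesis using that by (simp add: sum.delta)
  qed
  have W_supp: "w \<in> W" if "\<And>a. a < n \<Longrightarrow> a \<notin> S \<Longrightarrow> w a = 0" for w
    unfolding W_def
  proof (intro CollectI allI conjI impI)
    fix k j assume "j < m"
    then show "(\<Sum>a<n. w a * (A ^\<^sub>m k * B) $$ (a,j)) = 0"
      using that SB by (intro sum.neutral) (metis lessThan_iff mult_eq_0_iff)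
  next
    fix k j assume "j < n" "j \<notin> T"
    then show "(\<Sum>a<n. w a * (A ^\<^sub>m k) $$ (a,j)) = 0"
      using that SA by (intro sum.neutral) (metis lessThan_iff mult_eq_0_iff)
  qed
  have W_A: "(\<lambda>b. \<Sum>a<n. w a * A $$ (a,b)) \<in> W" if w: "w \<in> W" for w
    unfolding W_def
  proof (intro CollectI allI conjI impI)
    fix k j assume j: "j < m"
    have Ak: "A ^\<^sub>m k \<in> carrier_mat n n" using A by simp
    have eq: "A ^\<^sub>m Suc k * B = A * (A ^\<^sub>m k * B)"
      using pow_mat_commute[OF A, of k] assoc_mult_mat[OF A Ak B] by simp
    have "(\<Sum>a<n. w a * (A * (A ^\<^sub>m k * B)) $$ (a,j)) = 0"
      by (rule W_B[OF w j, of "Suc k", unfolded eq])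
    moreover have "A ^\<^sub>m k * B \<in> carrier_mat n m" using Ak B by simp
    ultimately show "(\<Sum>b<n. (\<Sum>a<n. w a * A $$ (a,b)) * (A ^\<^sub>m k * B) $$ (b,j)) = 0"
      using sum_mult_mat_assoc[OF A _ j, of "A ^\<^sub>m k * B" w] by simp
  next
    fix k j assume j: "j < n" "j \<notin> T"
    have Ak: "A ^\<^sub>m k \<in> carrier_mat n n" using A by simp
    have eq: "A ^\<^sub>m Suc k = A * A ^\<^sub>m k" using pow_mat_commute[OF A, of k] by simp
    have "(\<Sum>a<n. w a * (A * A ^\<^sub>m k) $$ (a,j)) = 0"
      by (rule W_pow[OF w j, of "Suc k", unfolded eq])
    then show "(\<Sum>b<n. (\<Sum>a<n. w a * A $$ (a,b)) * (A ^\<^sub>m k) $$ (b,j)) = 0"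
      using sum_mult_mat_assoc[OF A Ak j(1), of w] by simp
  qed
  have W_add: "(\<lambda>b. u b + w b) \<in> W" if "u \<in> W" "w \<in> W" for u w
    using that unfolding W_def by (simp add: distrib_right sum.distrib)
  \<comment> \<open>Membership depends only on entries below \<open>n\<close>: the difference
    vanishes there, so \<open>W_supp\<close> applies to it.\<close>
  have W_cong: "u \<in> W" if "w \<in> W" "\<And>a. a < n \<Longrightarrow> u a = w a" for u w
  proof -
    have "(\<lambda>b. w b + (u b - w b)) \<in> W" by (rule W_add[OF that(1) W_supp]) (simp add: that(2))
    then show ?thesis by simp
  qed
  \<comment> \<open>Vectors in \<open>W\<close> are supported on \<open>T\<close>, so multiplying by
    the perturbation gives a vector supported on \<open>S\<close>, again in
    \<open>W\<close>.\<close>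
  have W_A': "(\<lambda>b. \<Sum>a<n. w a * ?A $$ (a,b)) \<in> W" if w: "w \<in> W" for w
  proof (rule W_cong[OF W_add[OF W_A[OF w]]])
    show "(\<lambda>b. \<Sum>a<n. w a * dA \<theta> $$ (a,b)) \<in> W"
    proof (rule W_supp, rule sum.neutral, rule ballI)
      fix b a assume "b < n" "b \<notin> S" "a \<in> {..<n}"
      then show "w a * dA \<theta> $$ (a,b) = 0" using W_T[OF w, of a] dA0[of a b] by (cases "a \<in> T") auto
    qed
    show "(\<Sum>a<n. w a * ?A $$ (a,b)) = (\<Sum>a<n. w a * A $$ (a,b)) + (\<Sum>a<n. w a * dA \<theta> $$ (a,b))"
      if "b < n" for b
      unfolding sum.distrib[symmetric] using that AE by (intro sum.cong) (auto simp: distrib_left simp del: index_add_mat)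
  qed
  have W_B': "(\<Sum>a<n. w a * ?B $$ (a,j)) = 0" if w: "w \<in> W" and j: "j < m" for w j
  proof -
    have "(\<Sum>a<n. w a * ?B $$ (a,j)) = (\<Sum>a<n. w a * B $$ (a,j)) + (\<Sum>a<n. w a * dB \<theta> $$ (a,j))"
      unfolding sum.distrib[symmetric] using j BE by (intro sum.cong) (auto simp: distrib_left simp del: index_add_mat)
    also have "(\<Sum>a<n. w a * dB \<theta> $$ (a,j)) = 0"
    proof (rule sum.neutral, rule ballI)
      fix a assume "a \<in> {..<n}"
      then show "w a * dB \<theta> $$ (a,j) = 0" using W_T[OF w, of a] dB0[of a j] j by (cases "a \<in> T") auto
    qed
    also have "(\<Sum>a<n. w a * B $$ (a,j)) = (\<Sum>a<n. w a * (A ^\<^sub>m 0 * B) $$ (a,j))"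
      using A B by simp
    also have "\<dots> = 0" by (rule W_B[OF w j])
    finally show ?thesis by simp
  qed
  define e where "e a = (if a = i then 1 else 0 :: real)" for a
  have "e \<in> W" by (rule W_supp) (use neg in0 in \<open>auto simp: e_def S_def\<close>)
  have pow: "(\<lambda>b. \<Sum>a<n. e a * (?A ^\<^sub>m k) $$ (a,b)) \<in> W" for k
  proof (induction k)
    case 0
    show ?case
    proof (rule W_cong[OF \<open>e \<in> W\<close>])
      fix b assume "b < n"
      have "(\<Sum>a<n. e a * (?A ^\<^sub>m 0) $$ (a,b)) = (\<Sum>a<n. if a = b then e a else 0)"
        using \<open>b < n\<close> carrier_matD[OF dA_carrier[of \<theta>]] by (intro sum.cong) auto
      then show "(\<Sum>a<n. e a * (?A ^\<^sub>m 0) $$ (a,b)) = e b" using \<open>b < n\<close> by (simp add: sum.delta)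
    qed
  next
    case (Suc k)
    have Ak: "?A ^\<^sub>m k \<in> carrier_mat n n" using A' by simp
    show ?case
      by (rule W_cong[OF W_A'[OF Suc]])
         (use sum_mult_mat_assoc[OF Ak A', of _ e] in simp)
  qed
  have "(\<Sum>a<n. e a * (?A ^\<^sub>m k * ?B) $$ (a,j)) = 0" if j: "j < m" for k j
  proof -
    have Ak: "?A ^\<^sub>m k \<in> carrier_mat n n" using A' by simp
    show ?thesis unfolding sum_mult_mat_assoc[OF Ak B' j] by (rule W_B'[OF pow j])
  qed
  then have "e i = 0" using ctrl in0 unfolding controllable_iff_annihilator[OF A' B'] by blast
  then show False by (simp add: e_def)
qed

end

section \<open>Matroid intersection\<close>

definition indep_cols :: "nat \<Rightarrow> nat set \<Rightarrow> (nat \<Rightarrow> nat \<Rightarrow> 'a::field) \<Rightarrow> bool" where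
  "indep_cols r I h \<longleftrightarrow>
     (\<forall>v. (\<forall>a<r. (\<Sum>k\<in>I. h a k * v k) = 0) \<longrightarrow> (\<forall>k\<in>I. v k = 0))"

lemma indep_cols_cong:
  assumes "\<And>a k. a < r \<Longrightarrow> k \<in> I \<Longrightarrow> h a k = h' a k"
  shows "indep_cols r I h = indep_cols r I h'"
proof -
  have "(\<Sum>k\<in>I. h a k * v k) = (\<Sum>k\<in>I. h' a k * v k)" if "a < r" for a v
    using assms that by (intro sum.cong) auto
  then show ?thesis unfolding indep_cols_def by simp
qed

lemma pick_lessThan: "i < r \<Longrightarrow> pick {..<r} i = i"
proof -
  assume i: "i < r"
  then have "{a \<in> {..<r}. a < i} = {..<i}" by auto
  then show ?thesis using pick_card_in_set[of i "{..<r}"] i by simp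
qed

lemma bij_betw_pick:
  assumes "finite I"
  shows "bij_betw (pick I) {..<card I} I"
proof -
  have "I \<subseteq> pick I ` {..<card I}"
  proof
    fix k assume k: "k \<in> I"
    have "card {a \<in> I. a < k} < card I"
      using k assms by (intro psubset_card_mono) auto
    then show "k \<in> pick I ` {..<card I}"
      by (intro image_eqI[of _ _ "card {a \<in> I. a < k}"]) (simp_all add: pick_card_in_set[OF k])
  qed
  moreover have "pick I ` {..<card I} \<subseteq> I" by (auto intro: pick_in_set_le)
  ultimately have im: "pick I ` {..<card I} = I" by blast
  then have "inj_on (pick I) {..<card I}" by (intro eq_card_imp_inj_on) auto
  then show ?thesis using im by (simp add: bij_betw_def)
qed

lemma rank_submatrix_eq_card_iff:
  fixes M :: "'a::field mat"
  assumes M: "M \<in> carrier_mat r c" and I: "I \<subseteq> {..<c}"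
  shows "vec_space.rank r (submatrix M {..<r} I) = card I \<longleftrightarrow> indep_cols r I (\<lambda>a k. M $$ (a,k))"
    and rank_submatrix_le_card: "vec_space.rank r (submatrix M {..<r} I) \<le> card I"
    and rank_submatrix_le: "vec_space.rank r (submatrix M {..<r} I) \<le> r"
proof -
  have fin: "finite I" using I finite_subset by blast
  have rs: "{i. i < dim_row M \<and> i \<in> {..<r}} = {..<r}" using M by auto
  have cs: "{j. j < dim_col M \<and> j \<in> I} = I" using M I by auto
  have S: "submatrix M {..<r} I \<in> carrier_mat r (card I)"
    by (simp add: submatrix_def rs[simplified] cs)
  have SE: "submatrix M {..<r} I $$ (a,j) = M $$ (a, pick I j)" if "a < r" "j < card I" for a j
    using submatrix_index[of a M "{..<r}" j I] that unfolding rs cs by (simp add: pick_lessThan)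
  show "vec_space.rank r (submatrix M {..<r} I) \<le> card I" by (rule vec_space.rank_le_nc[OF S])
  show "vec_space.rank r (submatrix M {..<r} I) \<le> r" by (rule rank_le_dim_row[OF S])
  have bij: "bij_betw (pick I) {..<card I} I" by (rule bij_betw_pick[OF fin])
  have sm: "(\<Sum>j<card I. submatrix M {..<r} I $$ (a,j) * v (pick I j)) = (\<Sum>k\<in>I. M $$ (a,k) * v k)" if "a < r" for a v
    unfolding sum.reindex_bij_betw[OF bij, symmetric, of "\<lambda>k. M $$ (a,k) * v k"]
    by (intro sum.cong) (use that SE in auto)
  show "vec_space.rank r (submatrix M {..<r} I) = card I \<longleftrightarrow> indep_cols r I (\<lambda>a k. M $$ (a,k))"
    unfolding rank_eq_dim_col_iff[OF S] indep_cols_def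
  proof (intro iffI allI impI ballI)
    fix v k
    assume L: "\<forall>v. (\<forall>i<r. (\<Sum>j<card I. submatrix M {..<r} I $$ (i, j) * v j) = 0) \<longrightarrow> (\<forall>j<card I. v j = 0)"
      and v: "\<forall>a<r. (\<Sum>k\<in>I. M $$ (a, k) * v k) = 0" and k: "k \<in> I"
    obtain j where "j < card I" "k = pick I j" using bij k unfolding bij_betw_def by blast
    then show "v k = 0" using L[rule_format, of "\<lambda>j. v (pick I j)" j] v sm by simp
  next
    fix v j
    assume R: "\<forall>v. (\<forall>a<r. (\<Sum>k\<in>I. M $$ (a, k) * v k) = 0) \<longrightarrow> (\<forall>k\<in>I. v k = 0)"
      and v: "\<forall>i<r. (\<Sum>j<card I. submatrix M {..<r} I $$ (i, j) * v j) = 0" and j: "j < card I"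
    define w where "w = (\<lambda>k. v (inv_into {..<card I} (pick I) k))"
    have wv: "w (pick I j) = v j" if "j < card I" for j
      using bij that unfolding w_def bij_betw_def by (simp add: inv_into_f_f)
    have "(\<Sum>k\<in>I. M $$ (a, k) * w k) = 0" if "a < r" for a
    proof -
      have "(\<Sum>j<card I. submatrix M {..<r} I $$ (a,j) * w (pick I j)) = (\<Sum>j<card I. submatrix M {..<r} I $$ (a,j) * v j)"
        by (intro sum.cong) (auto simp: wv)
      then show ?thesis using sm[OF that, of w] v that by simp
    qed
    then have "w (pick I j) = 0" using R bij j unfolding bij_betw_def by blast
    then show "v j = 0" using wv[OF j] by simp
  qed
qed

lemma col_indep_iff:
  fixes W :: "'a::field mat"
  assumes "W \<in> carrier_mat r c"
  shows "col_indep W I \<longleftrightarrow> I \<subseteq> {..<c} \<and> indep_cols r I (\<lambda>a k. W $$ (a,k))"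
  using assms unfolding col_indep_def by (auto simp: rank_submatrix_eq_card_iff(1)[OF assms])

lemma pattern_col_indep_iff:
  assumes P: "P \<in> carrier_mat r c"
  shows "pattern_col_indep P I \<longleftrightarrow>
    I \<subseteq> {..<c} \<and> (\<exists>M \<in> realizations P. indep_cols r I (\<lambda>a k. M $$ (a,k)))"
proof (cases "I \<subseteq> {..<c}")
  case I: True
  have car: "M \<in> carrier_mat r c" if "M \<in> realizations P" for M
    using that P by (simp add: realizations_def)
  have ne: "realizations P \<noteq> {}"
    using P by (auto simp: realizations_def intro!: exI[of _ "0\<^sub>m r c"])
  let ?rk = "\<lambda>M :: real mat. vec_space.rank r (submatrix M {..<r} I)"
  have "{?rk M | M. M \<in> realizations P} = ?rk ` realizations P" by blast
  moreover have "Max (?rk ` realizations P) = card I \<longleftrightarrow> card I \<in> ?rk ` realizations P"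
    using ne rank_submatrix_le_card[OF car I] by (intro Max_eq_bound_iff) auto
  moreover have "card I \<in> ?rk ` realizations P \<longleftrightarrow> (\<exists>M \<in> realizations P. indep_cols r I (\<lambda>a k. M $$ (a,k)))"
    unfolding image_iff eq_commute[of "card I"] by (intro bex_cong refl rank_submatrix_eq_card_iff(1)[OF car I])
  ultimately show ?thesis using P I unfolding pattern_col_indep_def by simp
qed (use P in \<open>auto simp: pattern_col_indep_def\<close>)

lemma det_neq_0_iff_indep_cols:
  fixes h :: "nat \<Rightarrow> nat \<Rightarrow> 'a::field"
  assumes inj: "inj_on g {..<n}"
  shows "det (mat n n (\<lambda>(a,b). h a (g b))) \<noteq> 0 \<longleftrightarrow> indep_cols n (g ` {..<n}) h"
proof -
  have "mat n n (\<lambda>(b,a). h a (g b)) = transpose_mat (mat n n (\<lambda>(a,b). h a (g b)))"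
    by (intro eq_matI) auto
  then have "det (mat n n (\<lambda>(a,b). h a (g b))) = det (mat n n (\<lambda>(b,a). h a (g b)))"
    by (simp add: det_transpose[of _ n])
  then have "det (mat n n (\<lambda>(a,b). h a (g b))) \<noteq> 0 \<longleftrightarrow>
      (\<forall>q. (\<forall>a<n. (\<Sum>b<n. q b * h a (g b)) = 0) \<longrightarrow> (\<forall>b<n. q b = 0))"
    using det_eq_0_iff_left_kernel[of n "\<lambda>b a. h a (g b)"] by auto
  also have "\<dots> \<longleftrightarrow> indep_cols n (g ` {..<n}) h"
    unfolding indep_cols_def
  proof (intro iffI allI impI ballI)
    fix v k
    assume L: "\<forall>q. (\<forall>a<n. (\<Sum>b<n. q b * h a (g b)) = 0) \<longrightarrow> (\<forall>b<n. q b = 0)"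
      and v: "\<forall>a<n. (\<Sum>k\<in>g ` {..<n}. h a k * v k) = 0" and k: "k \<in> g ` {..<n}"
    obtain b where b: "b < n" "k = g b" using k by blast
    have "\<forall>a<n. (\<Sum>b<n. v (g b) * h a (g b)) = 0"
      using v unfolding sum.reindex[OF inj] by (simp add: mult.commute)
    then show "v k = 0" using L[rule_format, of "\<lambda>b. v (g b)" b] b by simp
  next
    fix q b
    assume R: "\<forall>v. (\<forall>a<n. (\<Sum>k\<in>g ` {..<n}. h a k * v k) = 0) \<longrightarrow> (\<forall>k\<in>g ` {..<n}. v k = 0)"
      and q: "\<forall>a<n. (\<Sum>b<n. q b * h a (g b)) = 0" and b: "b < n"
    define v where "v = (\<lambda>k. q (inv_into {..<n} g k))"
    have vq: "v (g b) = q b" if "b < n" for b using inj that unfolding v_def by (simp add: inv_into_f_f)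
    have "(\<Sum>k\<in>g ` {..<n}. h a k * v k) = (\<Sum>b<n. q b * h a (g b))" for a
      unfolding sum.reindex[OF inj] by (intro sum.cong) (auto simp: vq)
    then have "v (g b) = 0" using R[rule_format, of v "g b"] q b by simp
    then show "q b = 0" using vq[OF b] by simp
  qed
  finally show ?thesis .
qed

text \<open>The coefficients are the cofactors along column \<open>s\<close>, which do not see
  \<open>u\<close>.\<close>

lemma det_linear_in_column:
  fixes h :: "nat \<Rightarrow> nat \<Rightarrow> 'a::comm_ring_1"
  assumes s: "s < n"
  obtains C where "\<And>u. det (mat n n (\<lambda>(a,b). if b = s then u a else h a b)) = (\<Sum>a<n. u a * C a)"
proof -
  define M where "M u = mat n n (\<lambda>(a,b). if b = s then u a else h a b)" for u
  have "det (M u) = (\<Sum>a<n. u a * cofactor (M (\<lambda>_. 0)) a s)" for u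
  proof -
    have "det (M u) = (\<Sum>a<n. M u $$ (a,s) * cofactor (M u) a s)"
      by (rule laplace_expansion_column[OF _ s]) (simp add: M_def)
    also have "\<dots> = (\<Sum>a<n. u a * cofactor (M (\<lambda>_. 0)) a s)"
    proof (rule sum.cong[OF refl])
      fix a assume a: "a \<in> {..<n}"
      have "mat_delete (M u) a s = mat_delete (M (\<lambda>_. 0)) a s"
        unfolding mat_delete_def M_def using a s by (intro eq_matI) auto
      then have "cofactor (M u) a s = cofactor (M (\<lambda>_. 0)) a s" by (simp add: cofactor_def)
      moreover have "M u $$ (a,s) = u a" using a s by (simp add: M_def)
      ultimately show "M u $$ (a,s) * cofactor (M u) a s = u a * cofactor (M (\<lambda>_. 0)) a s" by simp
    qed
    finally show ?thesis .
  qed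
  from this[unfolded M_def] show thesis by (rule that)
qed

section \<open>Common independent sets and the rank of the perturbed pencil\<close>

context perturbed_system
begin

definition num_entry :: "complex \<Rightarrow> nat \<Rightarrow> nat \<Rightarrow> complex" where
  "num_entry \<mu> a k = (if k < n then (if a = k then 1 else 0) else ent (\<lambda>_. 0) \<mu> a (k - n))"

lemma W_num_carrier: "W_num A B \<mu> \<in> carrier_mat n (2 * n + m)"
proof -
  have "W_num A B \<mu> \<in> carrier_mat n ((n + n) + m)"
    unfolding W_num_def using A B by (intro hconcat_carrier) (auto intro!: minus_carrier_mat)
  then show ?thesis by (simp add: mult_2)
qed

lemma W_num_index:
  assumes "a < n" "k < 2 * n + m"
  shows "W_num A B \<mu> $$ (a,k) = num_entry \<mu> a k"
  using assms A B by (auto simp: W_num_def hconcat_def num_entry_def ent_zero not_less)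

lemma W_pattern_carrier: "W_pattern PA PB \<in> carrier_mat (n + m) (2 * n + m)"
  using PA PB by (auto simp: W_pattern_def hconcat_def diag_pattern_def)

lemma W_pattern_index:
  assumes "r < n + m" "k < 2 * n + m"
  shows "W_pattern PA PB $$ (r,k) = (if k < n then star k r else k = n + r)"
  using assms PA PB by (auto simp: W_pattern_def hconcat_def diag_pattern_def star_def)

lemma ent_eq: "a < n \<Longrightarrow> k < n + m \<Longrightarrow>
    ent \<theta> \<mu> a k = ent (\<lambda>_. 0) \<mu> a k + (if star a k then of_real (\<theta> (a,k)) else 0)"
  by (simp add: ent_def pert_poly_def)

text \<open>The columns \<open>I\<close> of [I, \<mu>I - A, B] times the transposed columns
  \<open>I\<close> of \<open>M\<close> form a matrix of full row rank. Its column \<open>r\<close>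
  is column \<open>r\<close> of \<open>Q\<close>, supported on free positions, plus
  \<open>D r\<close> times the unperturbed pencil column. Once the diagonal \<open>D\<close> is
  invertible, dividing by it leaves a perturbed pencil.\<close>

lemma common_independent_imp_full_row:
  assumes I: "I \<subseteq> {..<2 * n + m}" "card I = n" and ind1: "indep_cols n I (num_entry \<mu>)"
    and M: "M \<in> realizations (W_pattern PA PB)" and ind2: "indep_cols (n + m) I (\<lambda>a k. M $$ (a,k))"
  shows "\<exists>\<theta>. full_row n {..<n+m} (ent \<theta> \<mu>)"
proof -
  have fin: "finite I" using I finite_subset by blast
  have Mz: "M $$ (r,k) = 0" if "r < n + m" "k < 2 * n + m" "\<not> (if k < n then star k r else k = n + r)" for r k
    using M that W_pattern_carrier W_pattern_index[OF that(1,2)] unfolding realizations_def by auto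
  obtain g where g: "bij_betw g {..<n} I"
    using fin I(2) ex_bij_betw_nat_finite atLeast0LessThan by metis
  have gI: "g ` {..<n} = I" and ginj: "inj_on g {..<n}" using g by (auto simp: bij_betw_def)
  have full1: "full_row n I (num_entry \<mu>)"
    using ind1 unfolding gI[symmetric] det_neq_0_iff_indep_cols[OF ginj, symmetric] det_neq_0_iff_full_row .
  define Q where "Q a r = (if a \<in> I then M $$ (r,a) else 0)" for a r
  define D where "D r = (if n + r \<in> I then M $$ (r, n + r) else 0)" for r
  have Zeq: "(\<Sum>k\<in>I. num_entry \<mu> a k * of_real (M $$ (r,k))) = of_real (Q a r) + ent (\<lambda>_. 0) \<mu> a r * of_real (D r)"
    if a: "a < n" and r: "r < n + m" for a r
  proof -
    have "(\<Sum>k\<in>I. num_entry \<mu> a k * of_real (M $$ (r,k))) =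
        (\<Sum>k\<in>I. (if k = a then of_real (M $$ (r,a)) else 0) + (if k = n + r then ent (\<lambda>_. 0) \<mu> a r * of_real (M $$ (r, n + r)) else 0))"
    proof (rule sum.cong[OF refl])
      fix k assume "k \<in> I"
      then have k: "k < 2 * n + m" using I by auto
      show "num_entry \<mu> a k * of_real (M $$ (r,k)) =
          (if k = a then of_real (M $$ (r,a)) else 0) + (if k = n + r then ent (\<lambda>_. 0) \<mu> a r * of_real (M $$ (r, n + r)) else 0)"
        using a r Mz[OF r k] by (auto simp: num_entry_def)
    qed
    also have "\<dots> = of_real (Q a r) + ent (\<lambda>_. 0) \<mu> a r * of_real (D r)"
      using fin by (simp add: sum.distrib sum.delta' sum.delta Q_def D_def)
    finally show ?thesis .
  qed
  have full0: "full_row n {..<n+m} (\<lambda>a r. of_real (Q a r) + ent (\<lambda>_. 0) \<mu> a r * of_real (D r))"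
    unfolding full_row_def
  proof (intro allI impI)
    fix q a
    assume q: "\<forall>r\<in>{..<n+m}. (\<Sum>a<n. q a * (of_real (Q a r) + ent (\<lambda>_. 0) \<mu> a r * of_real (D r))) = 0" and a: "a < n"
    define v where "v k = (\<Sum>a<n. q a * num_entry \<mu> a k)" for k
    have vM: "(\<Sum>k\<in>I. of_real (M $$ (r,k)) * v k) = 0" if r: "r < n + m" for r
    proof -
      have "(\<Sum>k\<in>I. of_real (M $$ (r,k)) * v k) = (\<Sum>k\<in>I. \<Sum>a<n. q a * (num_entry \<mu> a k * of_real (M $$ (r,k))))"
        unfolding v_def sum_distrib_left by (intro sum.cong refl) (simp add: ac_simps)
      also have "\<dots> = (\<Sum>a<n. \<Sum>k\<in>I. q a * (num_entry \<mu> a k * of_real (M $$ (r,k))))" by (rule sum.swap)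
      also have "\<dots> = (\<Sum>a<n. q a * (of_real (Q a r) + ent (\<lambda>_. 0) \<mu> a r * of_real (D r)))"
        unfolding sum_distrib_left[symmetric] by (intro sum.cong refl) (simp add: Zeq r)
      finally show ?thesis using q r by simp
    qed
    \<comment> \<open>\<open>M\<close> has independent columns over the reals while \<open>v\<close>
      is complex, so its two parts are tested separately.\<close>
    have re: "Re (v k) = 0" if "k \<in> I" for k
    proof -
      have "(\<Sum>k\<in>I. M $$ (r,k) * Re (v k)) = 0" if "r < n + m" for r
        using arg_cong[OF vM[OF that], of Re] by simp
      then show ?thesis using ind2[unfolded indep_cols_def, rule_format, of "\<lambda>k. Re (v k)" k] that by simp
    qed
    have im: "Im (v k) = 0" if "k \<in> I" for k
    proof -
      have "(\<Sum>k\<in>I. M $$ (r,k) * Im (v k)) = 0" if "r < n + m" for r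
        using arg_cong[OF vM[OF that], of Im] by simp
      then show ?thesis using ind2[unfolded indep_cols_def, rule_format, of "\<lambda>k. Im (v k)" k] that by simp
    qed
    have "v k = 0" if "k \<in> I" for k using re[OF that] im[OF that] by (simp add: complex_eq_iff)
    then show "q a = 0" using full_rowD[OF full1 _ a, of q] by (simp add: v_def)
  qed
  \<comment> \<open>Shifting the diagonal by a generic real number makes it invertible without losing rank.\<close>
  define H where "H a r = [:of_real (Q a r) + ent (\<lambda>_. 0) \<mu> a r * of_real (D r), ent (\<lambda>_. 0) \<mu> a r:]" for a r
  have H: "poly (pert_poly H (\<lambda>_ _. False) (\<lambda>_. 0) a r) (of_real \<epsilon>) = of_real (Q a r) + ent (\<lambda>_. 0) \<mu> a r * of_real (D r + \<epsilon>)" for a r \<epsilon>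
    by (simp add: pert_poly_def H_def algebra_simps)
  have "full_row n {..<n+m} (\<lambda>a r. poly (pert_poly H (\<lambda>_ _. False) (\<lambda>_. 0) a r) (of_real 0))"
    unfolding H using full0 by simp
  then obtain f where f: "f \<in> {..<n} \<rightarrow>\<^sub>E {..<n+m}" "poly (pert_minor H (\<lambda>_ _. False) n f (\<lambda>_. 0)) (of_real 0) \<noteq> 0"
    unfolding full_row_iff_pert_minor[OF finite_lessThan] by blast
  define p where "p = pert_minor H (\<lambda>_ _. False) n f (\<lambda>_. 0)"
  have "p \<noteq> 0" using f(2) unfolding p_def[symmetric] by (rule contrapos_nn) simp
  then have "finite {z. poly p z = 0}" by (rule poly_roots_finite)
  then have "finite {\<epsilon>. poly p (of_real \<epsilon>) = 0}"
    using finite_vimageI[of "{z. poly p z = 0}" complex_of_real] by (simp add: vimage_def inj_on_def)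
  then have "finite ({\<epsilon>. poly p (of_real \<epsilon>) = 0} \<union> (\<lambda>r. - D r) ` {..<n+m})" by simp
  then obtain \<epsilon> where "\<epsilon> \<notin> {\<epsilon>. poly p (of_real \<epsilon>) = 0} \<union> (\<lambda>r. - D r) ` {..<n+m}"
    using ex_new_if_finite[OF infinite_UNIV_char_0] by blast
  then have e1: "poly p (of_real \<epsilon>) \<noteq> 0" and e2: "\<And>r. r < n + m \<Longrightarrow> D r + \<epsilon> \<noteq> 0"
    by (auto simp: image_iff add_eq_0_iff)
  have "full_row n {..<n+m} (\<lambda>a r. poly (pert_poly H (\<lambda>_ _. False) (\<lambda>_. 0) a r) (of_real \<epsilon>))"
    unfolding full_row_iff_pert_minor[OF finite_lessThan] using f(1) e1 unfolding p_def by blast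
  then have full\<epsilon>: "full_row n {..<n+m} (\<lambda>a r. of_real (Q a r) + ent (\<lambda>_. 0) \<mu> a r * of_real (D r + \<epsilon>))"
    unfolding H .
  define \<theta> where "\<theta> = (\<lambda>(a,r). Q a r / (D r + \<epsilon>))"
  have scaled: "of_real (Q a r) + ent (\<lambda>_. 0) \<mu> a r * of_real (D r + \<epsilon>) = ent \<theta> \<mu> a r * of_real (D r + \<epsilon>)"
    if "a < n" "r < n + m" for a r
  proof -
    have "Q a r = 0" if "\<not> star a r" using Mz[of r a] \<open>a < n\<close> \<open>r < n + m\<close> that by (auto simp: Q_def)
    then have "of_real (Q a r) = (if star a r then of_real (\<theta> (a,r)) else 0) * complex_of_real (D r + \<epsilon>)"
      using e2[OF that(2)] by (auto simp: \<theta>_def simp del: of_real_add)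
    then show ?thesis unfolding ent_eq[OF that, of \<theta>] by (simp only: distrib_right add.commute)
  qed
  have "full_row n {..<n+m} (ent \<theta> \<mu>)"
    unfolding full_row_def
  proof (intro allI impI)
    fix q a assume q: "\<forall>k\<in>{..<n+m}. (\<Sum>a<n. q a * ent \<theta> \<mu> a k) = 0" and a: "a < n"
    show "q a = 0"
    proof (rule full_rowD[OF full\<epsilon> _ a])
      fix r assume r: "r \<in> {..<n+m}"
      have "(\<Sum>a<n. q a * (of_real (Q a r) + ent (\<lambda>_. 0) \<mu> a r * of_real (D r + \<epsilon>))) = (\<Sum>a<n. q a * ent \<theta> \<mu> a r) * of_real (D r + \<epsilon>)"
        unfolding sum_distrib_right using r by (intro sum.cong refl) (simp only: scaled lessThan_iff mult.assoc)
      then show "(\<Sum>a<n. q a * (of_real (Q a r) + ent (\<lambda>_. 0) \<mu> a r * of_real (D r + \<epsilon>))) = 0"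
        using q r by simp
    qed
  qed
  then show ?thesis by blast
qed

text \<open>Each column \<open>f b\<close> of a nonzero minor is traded for a column
  \<open>g b\<close> of \<open>W_num\<close>. The pairs (f b, g b) form a matching of rows and
  columns at stars of \<open>W_pattern\<close>, and the 0/1 matrix of this matching has independent
  columns because \<open>f\<close> and \<open>g\<close> are injective.\<close>

lemma full_row_imp_common_independent:
  assumes full: "full_row n {..<n+m} (ent \<theta> \<mu>)"
  obtains I M where "I \<subseteq> {..<2 * n + m}" "card I = n" "indep_cols n I (num_entry \<mu>)"
    "M \<in> realizations (W_pattern PA PB)" "indep_cols (n + m) I (\<lambda>a k. M $$ (a,k))"
proof -
  obtain f where f: "f \<in> {..<n} \<rightarrow>\<^sub>E {..<n+m}" and df: "det (mat n n (\<lambda>(a,b). ent \<theta> \<mu> a (f b))) \<noteq> 0"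
    by (rule full_row_imp_minor[OF finite_lessThan full])
  have flt: "f b < n + m" if "b < n" for b using PiE_mem[OF f, of b] that by simp
  have inj_of_det: "inj_on g {..<n}" if "det (mat n n (\<lambda>(a,b). h a (g b))) \<noteq> 0" for g and h :: "nat \<Rightarrow> nat \<Rightarrow> complex"
  proof (rule inj_onI, rule ccontr)
    fix b b' assume b: "b \<in> {..<n}" "b' \<in> {..<n}" "g b = g b'" "b \<noteq> b'"
    have "det (mat n n (\<lambda>(a,b). h a (g b))) = 0"
      using b by (intro det_identical_columns[of _ n b b']) (auto intro!: eq_vecI)
    with that show False by simp
  qed
  have finj: "inj_on f {..<n}" by (rule inj_of_det[where h = "ent \<theta> \<mu>", OF df])
  \<comment> \<open>These are the positions of the stars in row \<open>f b\<close> of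
    \<open>W_pattern\<close>.\<close>
  define ok where "ok b k \<longleftrightarrow> (if k < n then star k (f b) else k = n + f b)" for b k
  \<comment> \<open>Each column of the perturbed pencil is a combination of admissible columns of \<open>W_num\<close>, so by
    multilinearity the columns can be replaced one by one while the determinant stays nonzero.\<close>
  have "s \<le> n \<Longrightarrow> \<exists>g. (\<forall>b<s. ok b (g b)) \<and>
      det (mat n n (\<lambda>(a,b). if b < s then num_entry \<mu> a (g b) else ent \<theta> \<mu> a (f b))) \<noteq> 0" for s
  proof (induction s)
    case 0
    then show ?case using df by simp
  next
    case (Suc s)
    then obtain g where g: "\<And>b. b < s \<Longrightarrow> ok b (g b)"
      and dg: "det (mat n n (\<lambda>(a,b). if b < s then num_entry \<mu> a (g b) else ent \<theta> \<mu> a (f b))) \<noteq> 0" by auto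
    have s: "s < n" using Suc.prems by simp
    define h where "h a b = (if b < s then num_entry \<mu> a (g b) else ent \<theta> \<mu> a (f b))" for a b
    obtain C where C: "\<And>u. det (mat n n (\<lambda>(a,b). if b = s then u a else h a b)) = (\<Sum>a<n. u a * C a)"
      by (rule det_linear_in_column[OF s, of h]) blast
    have "mat n n (\<lambda>(a,b). if b < s then num_entry \<mu> a (g b) else ent \<theta> \<mu> a (f b)) =
        mat n n (\<lambda>(a,b). if b = s then ent \<theta> \<mu> a (f s) else h a b)"
      by (intro eq_matI) (auto simp: h_def)
    then have nz: "(\<Sum>a<n. ent \<theta> \<mu> a (f s) * C a) \<noteq> 0" using dg C by simp
    have "\<exists>k. ok s k \<and> (\<Sum>a<n. num_entry \<mu> a k * C a) \<noteq> 0"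
    proof (rule ccontr)
      assume "\<not> ?thesis"
      then have z: "(\<Sum>a<n. num_entry \<mu> a k * C a) = 0" if "ok s k" for k using that by blast
      have z1: "(\<Sum>a<n. ent (\<lambda>_. 0) \<mu> a (f s) * C a) = 0"
        using z[of "n + f s"] by (simp add: ok_def num_entry_def)
      have z2: "C c = 0" if "c < n" "star c (f s)" for c
      proof -
        have "(\<Sum>a<n. num_entry \<mu> a c * C a) = (\<Sum>a<n. if a = c then C a else 0)"
          using that by (intro sum.cong) (auto simp: num_entry_def)
        then show ?thesis using z[of c] that by (simp add: ok_def sum.delta)
      qed
      have "(\<Sum>a<n. ent \<theta> \<mu> a (f s) * C a) =
          (\<Sum>a<n. ent (\<lambda>_. 0) \<mu> a (f s) * C a) + (\<Sum>a<n. (if star a (f s) then of_real (\<theta> (a, f s)) else 0) * C a)"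
        unfolding sum.distrib[symmetric] using flt[OF s]
        by (intro sum.cong refl) (subst ent_eq[of _ _ \<theta>], auto simp: distrib_right)
      also have "(\<Sum>a<n. (if star a (f s) then of_real (\<theta> (a, f s)) else 0) * C a) = 0"
        using z2 by (intro sum.neutral) auto
      finally show False using nz z1 by simp
    qed
    then obtain k where k: "ok s k" "(\<Sum>a<n. num_entry \<mu> a k * C a) \<noteq> 0" by blast
    have "mat n n (\<lambda>(a,b). if b < Suc s then num_entry \<mu> a ((g(s := k)) b) else ent \<theta> \<mu> a (f b)) =
        mat n n (\<lambda>(a,b). if b = s then num_entry \<mu> a k else h a b)"
      by (intro eq_matI) (auto simp: h_def)
    then have "det (mat n n (\<lambda>(a,b). if b < Suc s then num_entry \<mu> a ((g(s := k)) b) else ent \<theta> \<mu> a (f b))) \<noteq> 0"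
      using C k(2) by simp
    moreover have "\<forall>b<Suc s. ok b ((g(s := k)) b)" using g k(1) by (auto simp: less_Suc_eq)
    ultimately show ?case by blast
  qed
  from this[of n] obtain g where ok: "\<And>b. b < n \<Longrightarrow> ok b (g b)"
    and dg: "det (mat n n (\<lambda>(a,b). if b < n then num_entry \<mu> a (g b) else ent \<theta> \<mu> a (f b))) \<noteq> 0" by auto
  have "mat n n (\<lambda>(a,b). if b < n then num_entry \<mu> a (g b) else ent \<theta> \<mu> a (f b)) = mat n n (\<lambda>(a,b). num_entry \<mu> a (g b))"
    by (intro eq_matI) auto
  then have dg: "det (mat n n (\<lambda>(a,b). num_entry \<mu> a (g b))) \<noteq> 0" using dg by simp
  have ginj: "inj_on g {..<n}" by (rule inj_of_det[where h = "num_entry \<mu>", OF dg])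
  define I where "I = g ` {..<n}"
  define M :: "real mat" where "M = mat (n + m) (2 * n + m) (\<lambda>(r,k). if \<exists>b<n. k = g b \<and> r = f b then 1 else 0)"
  have glt: "g b < 2 * n + m" if "b < n" for b
    using ok[OF that] flt[OF that] unfolding ok_def by (auto split: if_splits)
  show thesis
  proof (rule that)
    show "I \<subseteq> {..<2 * n + m}" using glt by (auto simp: I_def)
    show "card I = n" using ginj by (simp add: I_def card_image)
    show "indep_cols n I (num_entry \<mu>)"
      using dg unfolding I_def det_neq_0_iff_indep_cols[OF ginj] .
    have "W_pattern PA PB $$ (r,k)" if "r < n + m" "k < 2 * n + m" "b < n" "k = g b" "r = f b" for r k b
      using W_pattern_index[OF that(1,2)] ok[OF that(3)] that(4,5) unfolding ok_def by simp
    then show "M \<in> realizations (W_pattern PA PB)"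
      using W_pattern_carrier unfolding realizations_def by (auto simp: M_def)
    show "indep_cols (n + m) I (\<lambda>a k. M $$ (a,k))"
      unfolding indep_cols_def
    proof (intro allI impI ballI)
      fix v k assume v: "\<forall>r<n+m. (\<Sum>k\<in>I. M $$ (r,k) * v k) = 0" and "k \<in> I"
      then obtain b where b: "b < n" "k = g b" by (auto simp: I_def)
      have "M $$ (f b, g b') = (if b' = b then 1 else 0)" if "b' < n" for b'
        using that b flt[OF b(1)] glt[OF that] ginj finj by (auto simp: M_def inj_on_def)
      then have "(\<Sum>k\<in>I. M $$ (f b,k) * v k) = (\<Sum>b'<n. if b' = b then v (g b') else 0)"
        unfolding I_def sum.reindex[OF ginj] by (intro sum.cong) auto
      then show "v k = 0" using v flt[OF b(1)] b by (simp add: sum.delta)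
    qed
  qed
qed

lemma matroid_inter_card_iff:
  "matroid_inter_card (2 * n + m) (col_indep (W_num A B \<mu>)) (pattern_col_indep (W_pattern PA PB)) = n
     \<longleftrightarrow> (\<exists>\<theta>. full_row n {..<n+m} (ent \<theta> \<mu>))"
proof -
  define fam where "fam = {I. I \<subseteq> {..<2 * n + m} \<and> col_indep (W_num A B \<mu>) I \<and> pattern_col_indep (W_pattern PA PB) I}"
  have iff: "I \<in> fam \<longleftrightarrow> I \<subseteq> {..<2 * n + m} \<and> indep_cols n I (num_entry \<mu>) \<and>
      (\<exists>M \<in> realizations (W_pattern PA PB). indep_cols (n + m) I (\<lambda>a k. M $$ (a,k)))" for I
  proof -
    have "indep_cols n I (\<lambda>a k. W_num A B \<mu> $$ (a,k)) = indep_cols n I (num_entry \<mu>)" if "I \<subseteq> {..<2 * n + m}"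
      using that by (intro indep_cols_cong W_num_index) auto
    then show ?thesis
      unfolding fam_def col_indep_iff[OF W_num_carrier] pattern_col_indep_iff[OF W_pattern_carrier] by auto
  qed
  have "card I \<le> n" if "I \<in> fam" for I
    using that rank_submatrix_le[OF W_num_carrier[of \<mu>], of I] W_num_carrier[of \<mu>]
    unfolding fam_def col_indep_def by auto
  moreover have "{} \<in> fam"
    unfolding iff indep_cols_def
    using W_pattern_carrier by (auto simp: realizations_def intro!: exI[of _ "0\<^sub>m (n + m) (2 * n + m)"])
  ultimately have "Max (card ` fam) = n \<longleftrightarrow> n \<in> card ` fam" by (intro Max_eq_bound_iff) auto
  moreover have "{card I | I. I \<subseteq> {..<2 * n + m} \<and> col_indep (W_num A B \<mu>) I \<and> pattern_col_indep (W_pattern PA PB) I} = card ` fam"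
    unfolding fam_def by blast
  moreover have "n \<in> card ` fam \<longleftrightarrow> (\<exists>\<theta>. full_row n {..<n+m} (ent \<theta> \<mu>))"
  proof
    assume "n \<in> card ` fam"
    then obtain I where "I \<in> fam" "card I = n" by blast
    then show "\<exists>\<theta>. full_row n {..<n+m} (ent \<theta> \<mu>)"
      unfolding iff using common_independent_imp_full_row by blast
  next
    assume "\<exists>\<theta>. full_row n {..<n+m} (ent \<theta> \<mu>)"
    then obtain \<theta> where "full_row n {..<n+m} (ent \<theta> \<mu>)" by blast
    then obtain I M where "I \<subseteq> {..<2 * n + m}" "card I = n" "indep_cols n I (num_entry \<mu>)"
      "M \<in> realizations (W_pattern PA PB)" "indep_cols (n + m) I (\<lambda>a k. M $$ (a,k))"
      by (rule full_row_imp_common_independent)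
    then show "n \<in> card ` fam" using iff[of I] by (metis imageI)
  qed
  ultimately show ?thesis unfolding matroid_inter_card_def by simp
qed

text \<open>An invertible resolvent has no zero row, so every \<open>Z i\<close> with
  \<open>i < n\<close> has an incoming edge in \<open>E_xz\<close>, and reachability of either end
  of it gives that of \<open>Z i\<close>. The remaining \<open>Z i\<close> are fed directly by
  inputs.\<close>

lemma edges_reachable_iff:
  "(\<forall>e \<in> E_xz A B. edge_input_reachable A B PA PB e) \<longleftrightarrow> (\<forall>i < n + m. input_reachable A B PA PB (Z i))"
proof
  assume all: "\<forall>i < n + m. input_reachable A B PA PB (Z i)"
  show "\<forall>e \<in> E_xz A B. edge_input_reachable A B PA PB e"
    using all A B unfolding E_xz_def edge_input_reachable_def by (auto simp: Let_def)
next
  assume edges: "\<forall>e \<in> E_xz A B. edge_input_reachable A B PA PB e"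
  show "\<forall>i < n + m. input_reachable A B PA PB (Z i)"
  proof (intro allI impI)
    fix i assume i: "i < n + m"
    show "input_reachable A B PA PB (Z i)"
    proof (cases "i < n")
      case False
      then show ?thesis using i by (simp add: input_column_reachable)
    next
      case True
      obtain \<mu> where "\<not> eigenvalue (cmat A) \<mu>"
        using ex_new_if_finite[OF infinite_UNIV_char_0 finite_eigenvalues] by blast
      then obtain R where R: "R \<in> carrier_mat n n" "R * (\<mu> \<cdot>\<^sub>m 1\<^sub>m n - cmat A) = 1\<^sub>m n"
        by (rule resolvent_exists)
      have N: "\<mu> \<cdot>\<^sub>m 1\<^sub>m n - cmat A \<in> carrier_mat n n" using A by (auto intro!: minus_carrier_mat)
      have "\<exists>j<n. R $$ (i,j) \<noteq> 0"
      proof (rule ccontr)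
        assume "\<not> ?thesis"
        then have "(R * (\<mu> \<cdot>\<^sub>m 1\<^sub>m n - cmat A)) $$ (i,i) = 0"
          unfolding index_mult_mat_sum[OF R(1) N True True] by (intro sum.neutral) auto
        then show False unfolding R(2) using True by simp
      qed
      then obtain j where j: "j < n" "R $$ (i,j) \<noteq> 0" by blast
      have "cmat (1\<^sub>m n) = 1\<^sub>m n" by (auto simp: cmat_def intro!: eq_matI)
      then have "(R * cmat (1\<^sub>m n)) $$ (i,j) \<noteq> 0" using R(1) j by simp
      then have "resolvent_entry_nz A (1\<^sub>m n) i j" unfolding resolvent_entry_nz_def using A R by auto
      then have e: "(X j, Z i) \<in> E_xz A B" using True j A B by (auto simp: E_xz_def Let_def)
      then have "input_reachable A B PA PB (X j) \<or> input_reachable A B PA PB (Z i)"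
        using edges unfolding edge_input_reachable_def by force
      then show ?thesis using input_reachable_step[of "X j" "Z i"] e by (auto simp: acg_edges_def)
    qed
  qed
qed

lemma struct_controllable_iff_rank_and_reachable:
  "struct_controllable A B PA PB \<longleftrightarrow>
     (\<forall>\<mu>. eigenvalue (cmat A) \<mu> \<longrightarrow> (\<exists>\<theta>. full_row n {..<n+m} (ent \<theta> \<mu>))) \<and>
     (\<forall>i < n + m. input_reachable A B PA PB (Z i))"
  using struct_controllableI struct_controllable_imp_reachable struct_controllable_iff by blast

end

theorem theorem1:
  fixes A B :: "real mat" and PA PB :: "bool mat" and n m :: nat
  assumes "A \<in> carrier_mat n n" and "B \<in> carrier_mat n m"
    and "PA \<in> carrier_mat n n" and "PB \<in> carrier_mat n m"
  shows "(struct_controllable A B PA PB \<longleftrightarrow>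
           ((\<forall>lam. eigenvalue (cmat A) lam \<longrightarrow> max_pert_rank A B PA PB lam = n) \<and>
            (\<forall>e \<in> E_xz A B. edge_input_reachable A B PA PB e)))
       \<and> (struct_controllable A B PA PB \<longleftrightarrow>
           ((\<forall>lam. eigenvalue (cmat A) lam \<longrightarrow>
               matroid_inter_card (2 * n + m) (col_indep (W_num A B lam))
                 (pattern_col_indep (W_pattern PA PB)) = n) \<and>
            (\<forall>i < n + m. input_reachable A B PA PB (Z i))))"
proof -
  interpret perturbed_system A B PA PB n m by unfold_locales (use assms in auto)
  show ?thesis
    unfolding struct_controllable_iff_rank_and_reachable max_pert_rank_iff
      matroid_inter_card_iff edges_reachable_iff by blast
qed

end
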